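(* The number of queries required to decide the existence of a connected strongly-proportional allocation for $n$ hungry agents (with possibly unequal entitlements), or to compute such an allocation if it exists, is in $\Theta(n\cdot 2^n)$.
   Context: The cake is $C=[0,1]$, to be divided among agents $[n]$. Each agent $i$ has a valuation function $V_i$ on the algebra generated by intervals of $C$ that is non-negative, finitely additive, normalized ($V_i(C)=1$), with $x\mapsto V_i([0,x])$ continuous. Agent $i$ is hungry if $V_i(X)>0$ for every interval $X$ of positive length. Entitlements are $w_i>0$ with $\sum_i w_i=1$. An allocation is a partition $C=X_1\sqcup\cdots\sqcup X_n$ into finite unions of closed intervals, pairwise disjoint except possibly at endpoints; it is connected if each $X_i$ is a single interval and strongly-proportional if $V_i(X_i)>w_i$ for all $i$. Algorithms access valuations only via queries (each counts as one): $\textsc{Eval}_i(x,y)=V_i([x,y])$; $\textsc{Mark}_i(x,r)$ returns the largest $z\in C$ with $V_i([x,z])=r$, or $\infty$ if $V_i([x,1])<r$. *)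

theory Defs
  imports "HOL-Analysis.Analysis" "HOL-Library.Landau_Symbols"
begin

definition cake :: "real set" where
  "cake = {0..1}"

definition cake_algebra :: "real set set" where
  "cake_algebra = \<Inter>{M. algebra cake M \<and> {X. is_interval X \<and> X \<subseteq> cake} \<subseteq> M}"

text \<open>Only the values on \<^const>\<open>cake_algebra\<close> matter. Continuity on \<open>[0,1]\<close> excludes atoms
  everywhere but at \<open>0\<close>; the condition \<open>v {0} = 0\<close> is continuity at the left end. It is what makes
  the mark query below well-defined, i.e. some \<open>z\<close> with \<open>v [x,z] = r\<close> exists whenever
  \<open>0 \<le> r \<le> v [x,1]\<close>.\<close>

definition valuation :: "(real set \<Rightarrow> real) \<Rightarrow> bool" where
  "valuation v \<longleftrightarrow>
     (\<forall>X\<in>cake_algebra. 0 \<le> v X) \<and> additive cake_algebra v \<and> v cake = 1 \<and>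
     v {0} = 0 \<and> continuous_on cake (\<lambda>x. v {0..x})"

definition hungry :: "(real set \<Rightarrow> real) \<Rightarrow> bool" where
  "hungry v \<longleftrightarrow> (\<forall>X. is_interval X \<and> X \<subseteq> cake \<and> measure lborel X > 0 \<longrightarrow> v X > 0)"

definition entitlements :: "nat \<Rightarrow> (nat \<Rightarrow> real) \<Rightarrow> bool" where
  "entitlements n w \<longleftrightarrow> (\<forall>i\<in>{1..n}. w i > 0) \<and> (\<Sum>i\<in>{1..n}. w i) = 1"

definition hungry_instance :: "nat \<Rightarrow> (nat \<Rightarrow> real) \<Rightarrow> (nat \<Rightarrow> real set \<Rightarrow> real) \<Rightarrow> bool" where
  "hungry_instance n w V \<longleftrightarrow>
     entitlements n w \<and> (\<forall>i\<in>{1..n}. valuation (V i) \<and> hungry (V i))"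

text \<open>For a finite union of closed intervals, the frontier consists of the endpoints of its
  maximal intervals.\<close>

definition allocation :: "nat \<Rightarrow> (nat \<Rightarrow> real set) \<Rightarrow> bool" where
  "allocation n X \<longleftrightarrow>
     (\<forall>i\<in>{1..n}. \<exists>F. finite F \<and> (\<forall>I\<in>F. \<exists>a b. I = {a..b}) \<and> X i = \<Union>F) \<and>
     (\<Union>i\<in>{1..n}. X i) = cake \<and>
     (\<forall>i\<in>{1..n}. \<forall>j\<in>{1..n}. i \<noteq> j \<longrightarrow> X i \<inter> X j \<subseteq> frontier (X i) \<inter> frontier (X j))"

definition connected_allocation :: "nat \<Rightarrow> (nat \<Rightarrow> real set) \<Rightarrow> bool" where
  "connected_allocation n X \<longleftrightarrow>
     allocation n X \<and> (\<forall>i\<in>{1..n}. \<exists>a b. a \<le> b \<and> X i = {a..b})"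

definition strongly_proportional ::
  "nat \<Rightarrow> (nat \<Rightarrow> real) \<Rightarrow> (nat \<Rightarrow> real set \<Rightarrow> real) \<Rightarrow> (nat \<Rightarrow> real set) \<Rightarrow> bool" where
  "strongly_proportional n w V X \<longleftrightarrow> (\<forall>i\<in>{1..n}. V i (X i) > w i)"

definition conn_strong_prop ::
  "nat \<Rightarrow> (nat \<Rightarrow> real) \<Rightarrow> (nat \<Rightarrow> real set \<Rightarrow> real) \<Rightarrow> (nat \<Rightarrow> real set) \<Rightarrow> bool" where
  "conn_strong_prop n w V X \<longleftrightarrow> connected_allocation n X \<and> strongly_proportional n w V X"

definition eval_query :: "(real set \<Rightarrow> real) \<Rightarrow> real \<Rightarrow> real \<Rightarrow> real" where
  "eval_query v x y = v {x..y}"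

definition mark_query :: "(real set \<Rightarrow> real) \<Rightarrow> real \<Rightarrow> real \<Rightarrow> ereal" where
  "mark_query v x r =
     (if v {x..1} < r then \<infinity> else ereal (GREATEST z. z \<in> cake \<and> v {x..z} = r))"

text \<open>A deterministic adaptive algorithm, as a decision tree: each inner node asks one query and
  continues depending on the answer. Computation between queries is unrestricted and free.
  Trees are well-founded, so every run terminates.\<close>

datatype 'a protocol =
    Return 'a
  | Eval nat real real "real \<Rightarrow> 'a protocol"
  | Mark nat real real "ereal \<Rightarrow> 'a protocol"

primrec legal :: "nat \<Rightarrow> 'a protocol \<Rightarrow> bool" where
  "legal n (Return a) \<longleftrightarrow> True"
| "legal n (Eval i x y k) \<longleftrightarrow> i \<in> {1..n} \<and> 0 \<le> x \<and> x \<le> y \<and> y \<le> 1 \<and> (\<forall>a. legal n (k a))"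
| "legal n (Mark i x r k) \<longleftrightarrow> i \<in> {1..n} \<and> x \<in> cake \<and> 0 \<le> r \<and> (\<forall>a. legal n (k a))"

primrec run :: "(nat \<Rightarrow> real set \<Rightarrow> real) \<Rightarrow> 'a protocol \<Rightarrow> 'a" where
  "run V (Return a) = a"
| "run V (Eval i x y k) = run V (k (eval_query (V i) x y))"
| "run V (Mark i x r k) = run V (k (mark_query (V i) x r))"

primrec queries :: "(nat \<Rightarrow> real set \<Rightarrow> real) \<Rightarrow> 'a protocol \<Rightarrow> nat" where
  "queries V (Return a) = 0"
| "queries V (Eval i x y k) = Suc (queries V (k (eval_query (V i) x y)))"
| "queries V (Mark i x r k) = Suc (queries V (k (mark_query (V i) x r)))"

text \<open>The worst-case number of queries needed for \<open>n\<close> agents on the instances in \<open>D\<close> to produce an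
  output related to the instance by \<open>R\<close>. The entitlements are known to the algorithm, so an
  algorithm is a family of protocols indexed by them. The value is \<open>\<infinity>\<close> if no algorithm has
  bounded worst-case cost.\<close>

definition query_complexity ::
  "nat \<Rightarrow> ((nat \<Rightarrow> real) \<times> (nat \<Rightarrow> real set \<Rightarrow> real)) set \<Rightarrow>
   ((nat \<Rightarrow> real) \<Rightarrow> (nat \<Rightarrow> real set \<Rightarrow> real) \<Rightarrow> 'a \<Rightarrow> bool) \<Rightarrow> enat" where
  "query_complexity n D R =
     (INF A \<in> {A. (\<forall>w. legal n (A w)) \<and> (\<forall>(w, V)\<in>D. R w V (run V (A w)))}.
        SUP (w, V) \<in> D. enat (queries V (A w)))"

definition decision_complexity :: "nat \<Rightarrow> enat" where
  "decision_complexity n =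
     query_complexity n {(w, V). hungry_instance n w V}
       (\<lambda>w V answer. answer \<longleftrightarrow> (\<exists>X. conn_strong_prop n w V X))"

definition search_complexity :: "nat \<Rightarrow> enat" where
  "search_complexity n =
     query_complexity n {(w, V). hungry_instance n w V \<and> (\<exists>X. conn_strong_prop n w V X)}
       (\<lambda>w V X. conn_strong_prop n w V X)"

end

theory Submission
  imports Defs "HOL-Library.Nat_Bijection"
begin

text \<open>Serve the agents in some order, from left to right, each with a piece worth exactly its
  entitlement. For hungry agents a connected strongly-proportional allocation exists iff for some
  order this ends before \<open>1\<close>: the slack at the right end can then be passed on to the left. The
  earliest end for a set \<open>S\<close> of agents is the minimum, over the agent \<open>i \<in> S\<close> served last, of the mark of
  \<open>i\<close> from the earliest end for \<open>S - {i}\<close>, so at most \<open>n * 2 ^ n\<close> mark queries determine it for all \<open>S\<close>.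

  For the lower bound take entitlements with distinct subset sums and an adversary that answers as
  if all valuations were uniform; then no such allocation exists. Each query involves only two values
  \<open>V i [0,x]\<close>. If for some \<open>i \<in> S\<close>, \<open>S\<close> not the set of all agents, the value at \<open>x = w S\<close> has not been
  involved, then increasing \<open>V i [0,x]\<close> slightly near that point lets \<open>i\<close> finish early after the rest of
  \<open>S\<close>, so that an allocation exists, and agent \<open>i\<close> must receive a piece that ends near \<open>w S\<close>. There are
  \<open>n * (2 ^ (n - 1) - 1)\<close> such pairs, and an algorithm has to involve almost all of them.\<close>

section \<open>Valuations and cut points\<close>

lemma interval_in_cake_algebra: "is_interval X \<Longrightarrow> X \<subseteq> cake \<Longrightarrow> X \<in> cake_algebra"
  unfolding cake_algebra_def by auto

text \<open>The Borel subsets of the cake form an algebra containing its intervals, hence they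
  include the generated algebra. This makes Lebesgue measure available on
  \<open>cake_algebra\<close>.\<close>

lemma cake_algebra_borel:
  assumes "X \<in> cake_algebra"
  shows "X \<in> sets lborel" "X \<subseteq> cake"
proof -
  have "algebra cake {X. X \<subseteq> cake \<and> X \<in> sets borel}"
    unfolding algebra_iff_Un by (auto simp: cake_def)
  moreover have "X \<in> sets borel" if "is_interval X" for X :: "real set"
    using that by (rule real_interval_borel_measurable)
  ultimately have "{X. X \<subseteq> cake \<and> X \<in> sets borel}
      \<in> {M. algebra cake M \<and> {X. is_interval X \<and> X \<subseteq> cake} \<subseteq> M}"
    by auto
  then have "X \<in> {X. X \<subseteq> cake \<and> X \<in> sets borel}"
    using assms unfolding cake_algebra_def by blast
  then show "X \<in> sets lborel" "X \<subseteq> cake" by auto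
qed

section \<open>Closed intervals under a hungry valuation\<close>

locale hungry_valuation =
  fixes v :: "real set \<Rightarrow> real"
  assumes valuation: "valuation v" and hungry: "hungry v"
begin

lemma additive_intervals:
  assumes "is_interval X" "is_interval Y" "X \<subseteq> cake" "Y \<subseteq> cake" "X \<inter> Y = {}"
    and "Z = X \<union> Y"
  shows "v Z = v X + v Y"
  using valuation assms interval_in_cake_algebra unfolding valuation_def additive_def by blast

lemma nonneg: "is_interval X \<Longrightarrow> X \<subseteq> cake \<Longrightarrow> 0 \<le> v X"
  using valuation interval_in_cake_algebra unfolding valuation_def by blast

lemma continuous: "continuous_on cake (\<lambda>x. v {0..x})"
  using valuation unfolding valuation_def by simp

text \<open>For \<open>x > 0\<close>, \<open>v {0..x}\<close> is the left limit of values
  \<open>v {0..y}\<close>, none of which exceeds \<open>v {0..<x}\<close>; so no atom sits at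
  \<open>x\<close>.\<close>

lemma point: assumes "0 \<le> x" "x \<le> 1" shows "v {x} = 0"
proof (cases "x = 0")
  case True
  then show ?thesis using valuation unfolding valuation_def by simp
next
  case False
  with assms have x: "0 < x" by simp
  have add: "v {0..x} = v {0..<x} + v {x}"
    by (rule additive_intervals) (use x assms in \<open>auto simp: cake_def is_interval_convex_1\<close>)
  have le: "v {0..y} \<le> v {0..<x}" if "0 \<le> y" "y < x" for y
  proof -
    have "v {0..<x} = v {0..y} + v {y<..<x}"
      by (rule additive_intervals) (use that assms in \<open>auto simp: cake_def is_interval_convex_1\<close>)
    moreover have "0 \<le> v {y<..<x}" using that assms
      by (intro nonneg) (auto simp: cake_def is_interval_convex_1)
    ultimately show ?thesis by simp
  qed
  have "continuous_on {0..x} (\<lambda>y. v {0..y})"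
    by (rule continuous_on_subset[OF continuous]) (use assms in \<open>auto simp: cake_def\<close>)
  then have "((\<lambda>y. v {0..y}) \<longlongrightarrow> v {0..x}) (at_left x)"
    using x by (rule continuous_on_Icc_at_leftD)
  then have "v {0..x} \<le> v {0..<x}"
    by (rule tendsto_upperbound)
       (use x le in \<open>auto simp: eventually_at_left intro!: exI[of _ 0]\<close>)
  moreover have "0 \<le> v {x}" using assms by (intro nonneg) (auto simp: cake_def is_interval_convex_1)
  ultimately show ?thesis using add by simp
qed

lemma split:
  assumes "0 \<le> x" "x \<le> y" "y \<le> z" "z \<le> 1"
  shows "v {x..z} = v {x..y} + v {y..z}"
proof -
  have "v {x..z} = v {x..y} + v {y<..z}" "v {y..z} = v {y} + v {y<..z}"
    by (rule additive_intervals; use assms in \<open>auto simp: cake_def is_interval_convex_1\<close>)+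
  then show ?thesis using point[of y] assms by simp
qed

lemma Icc_nonneg: "0 \<le> x \<Longrightarrow> y \<le> 1 \<Longrightarrow> 0 \<le> v {x..y}"
  by (rule nonneg) (auto simp: cake_def is_interval_convex_1)

lemma Icc_pos: "0 \<le> x \<Longrightarrow> x < y \<Longrightarrow> y \<le> 1 \<Longrightarrow> 0 < v {x..y}"
  using hungry unfolding hungry_def by (auto simp: cake_def is_interval_convex_1)

lemma Icc_mono:
  assumes "0 \<le> x'" "x' \<le> x" "x \<le> y" "y \<le> y'" "y' \<le> 1"
  shows "v {x..y} \<le> v {x'..y'}"
  using split[of x' x y'] split[of x y y'] Icc_nonneg[of x' x] Icc_nonneg[of y y'] assms by simp

lemma Icc_eqD:
  assumes "0 \<le> x" "x \<le> y" "x \<le> z" "y \<le> 1" "z \<le> 1" "v {x..y} = v {x..z}"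
  shows "y = z"
proof (cases y z rule: linorder_cases)
  case less
  then show ?thesis using assms split[of x y z] Icc_pos[of y z] by linarith
next
  case greater
  then show ?thesis using assms split[of x z y] Icc_pos[of z y] by linarith
qed

text \<open>Hungriness leaves one solution at or right of \<open>x\<close>; any other candidate lies
  left of \<open>x\<close>, so it cannot be the greatest.\<close>

lemma mark_query_eqI:
  assumes "0 \<le> x" "x \<le> z" "z \<le> 1" "v {x..z} = r"
  shows "mark_query v x r = ereal z"
proof -
  have "(GREATEST z. z \<in> cake \<and> v {x..z} = r) = z"
  proof (rule Greatest_equality)
    show "z \<in> cake \<and> v {x..z} = r" using assms by (auto simp: cake_def)
    fix y assume y: "y \<in> cake \<and> v {x..y} = r"
    show "y \<le> z"
      by (cases "x \<le> y") (use y assms Icc_eqD[of x y z] in \<open>auto simp: cake_def\<close>)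
  qed
  moreover have "r \<le> v {x..1}" using assms Icc_mono[of x x z 1] by simp
  ultimately show ?thesis by (simp add: mark_query_def)
qed

lemma ex_mark:
  assumes "0 \<le> x" "x \<le> 1" "0 \<le> r" "r \<le> v {x..1}"
  shows "\<exists>z. x \<le> z \<and> z \<le> 1 \<and> v {x..z} = r"
proof -
  have "continuous_on {x..1} (\<lambda>y. v {0..y})"
    by (rule continuous_on_subset[OF continuous]) (use assms in \<open>auto simp: cake_def\<close>)
  then have "\<exists>z\<ge>x. z \<le> 1 \<and> v {0..z} = v {0..x} + r"
    using assms split[of 0 x 1] by (intro IVT') auto
  then obtain z where z: "x \<le> z" "z \<le> 1" "v {0..z} = v {0..x} + r" by blast
  then have "v {x..z} = r" using split[of 0 x z] assms by simp
  with z show ?thesis by blast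
qed

end

text \<open>Answers \<open>\<ge> 1\<close>, in particular \<open>\<infinity>\<close>, become \<open>1\<close>; a cut at \<open>1\<close> signals failure, since a positive
  entitlement leaves nothing to be gained from \<open>[1,1]\<close>. Clipping also keeps queries legal on
  branches that no valuation produces.\<close>

definition clip :: "ereal \<Rightarrow> real" where
  "clip a = (if 1 \<le> a then 1 else if a \<le> 0 then 0 else real_of_ereal a)"

lemma clip_bounds: "0 \<le> clip a" "clip a \<le> 1"
  by (cases a; auto simp: clip_def)+

lemma clip_ereal: "0 \<le> x \<Longrightarrow> x \<le> 1 \<Longrightarrow> clip (ereal x) = x"
  by (auto simp: clip_def)

definition cut_point :: "(real set \<Rightarrow> real) \<Rightarrow> real \<Rightarrow> real \<Rightarrow> real" where
  "cut_point v x r = clip (mark_query v x r)"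

lemma cut_point_bounds: "0 \<le> cut_point v x r" "cut_point v x r \<le> 1"
  by (simp_all add: cut_point_def clip_bounds)

context hungry_valuation
begin

text \<open>In the case \<open>cut\<close> the cut may also lie at \<open>1\<close>; this is why
  \<open>value_cut'\<close> infers an exact value only from a cut below \<open>1\<close>.\<close>

lemma cut_cases:
  assumes "0 \<le> x" "x \<le> 1" "0 \<le> r"
  obtains (inf) "v {x..1} < r" "cut_point v x r = 1"
  | (cut) "x \<le> cut_point v x r" "v {x..cut_point v x r} = r"
proof (cases "v {x..1} < r")
  case True
  then show ?thesis by (intro inf) (auto simp: cut_point_def mark_query_def clip_def)
next
  case False
  then obtain z where z: "x \<le> z" "z \<le> 1" "v {x..z} = r" using ex_mark assms by force
  then have "cut_point v x r = z"
    unfolding cut_point_def using mark_query_eqI[of x z r] assms by (simp add: clip_ereal)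
  with z show ?thesis by (intro cut) auto
qed

lemma cut_ge: assumes "0 \<le> x" "x \<le> 1" "0 \<le> r" shows "x \<le> cut_point v x r"
  by (rule cut_cases[OF assms]) (use assms in auto)

lemma value_cut:
  assumes "0 \<le> x" "x \<le> 1" "0 \<le> r" "r \<le> v {x..1}"
  shows "v {x..cut_point v x r} = r"
  by (rule cut_cases[OF assms(1-3)]) (use assms in auto)

lemma value_cut':
  assumes "0 \<le> x" "x \<le> 1" "0 \<le> r" "cut_point v x r < 1"
  shows "v {x..cut_point v x r} = r"
  by (rule cut_cases[OF assms(1-3)]) (use assms in auto)

lemma cut_less:
  assumes "0 \<le> x" "x \<le> y" "y \<le> 1" "0 \<le> r" "r < v {x..y}"
  shows "cut_point v x r < y"
proof -
  have "r < v {x..1}" using Icc_mono[of x x y 1] assms by simp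
  then have e: "v {x..cut_point v x r} = r" using value_cut[of x r] assms by simp
  show ?thesis
  proof (rule ccontr)
    assume "\<not> ?thesis"
    then have "v {x..y} \<le> v {x..cut_point v x r}"
      using assms Icc_mono[of x x y "cut_point v x r"] cut_point_bounds[of v x r] by simp
    with e assms show False by simp
  qed
qed

lemma cut_le:
  assumes "0 \<le> x" "x \<le> y" "y \<le> 1" "0 \<le> r" "r \<le> v {x..y}"
  shows "cut_point v x r \<le> y"
proof -
  have "r \<le> v {x..1}" using Icc_mono[of x x y 1] assms by simp
  then have e: "v {x..cut_point v x r} = r" "x \<le> cut_point v x r"
    using value_cut[of x r] cut_ge[of x r] assms by simp_all
  show ?thesis
  proof (rule ccontr)
    assume "\<not> ?thesis"
    then have y: "y < cut_point v x r" by simp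
    have "v {x..cut_point v x r} = v {x..y} + v {y..cut_point v x r}" "0 < v {y..cut_point v x r}"
      using split[of x y "cut_point v x r"] Icc_pos[of y "cut_point v x r"] y assms cut_point_bounds[of v x r]
      by simp_all
    with e assms show False by simp
  qed
qed

text \<open>What suffices from \<open>y\<close> suffices from \<open>x\<close>. This lets the
  dynamic program keep only the earliest end for each set of agents.\<close>

lemma cut_mono:
  assumes "0 \<le> x" "x \<le> y" "y \<le> 1" "0 \<le> r"
  shows "cut_point v x r \<le> cut_point v y r"
proof (cases "cut_point v y r < 1")
  case True
  have y: "0 \<le> y" using assms by simp
  have "v {y..cut_point v y r} = r" "y \<le> cut_point v y r"
    by (rule value_cut'[OF y assms(3,4) True], rule cut_ge[OF y assms(3,4)])
  moreover have "v {y..cut_point v y r} \<le> v {x..cut_point v y r}"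
    using calculation assms cut_point_bounds[of v y r] by (intro Icc_mono) auto
  ultimately show ?thesis
    using assms cut_point_bounds[of v y r] cut_le[of x "cut_point v y r" r] by linarith
next
  case False
  then show ?thesis using cut_point_bounds[of v x r] by simp
qed

end

section \<open>Sweeps and connected allocations\<close>

definition sweep :: "(nat \<Rightarrow> real set \<Rightarrow> real) \<Rightarrow> (nat \<Rightarrow> real) \<Rightarrow> nat list \<Rightarrow> real \<Rightarrow> real" where
  "sweep V w \<pi> z = foldl (\<lambda>x i. cut_point (V i) x (w i)) z \<pi>"

lemma sweep_simps [simp]:
  "sweep V w [] z = z"
  "sweep V w (i # \<pi>) z = sweep V w \<pi> (cut_point (V i) z (w i))"
  "sweep V w (\<pi> @ \<rho>) z = sweep V w \<rho> (sweep V w \<pi> z)"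
  by (simp_all add: sweep_def)

lemma sweep_bounds:
  assumes "0 \<le> z" "z \<le> 1"
  shows "0 \<le> sweep V w \<pi> z" "sweep V w \<pi> z \<le> 1"
  using assms by (induction \<pi> arbitrary: z) (simp_all add: cut_point_bounds)

lemma hungry_instanceD:
  assumes "hungry_instance n w V"
  shows "i \<in> {1..n} \<Longrightarrow> hungry_valuation (V i)" "i \<in> {1..n} \<Longrightarrow> 0 < w i"
    "sum w {1..n} = 1" "0 < n"
proof -
  have e: "entitlements n w" using assms by (simp add: hungry_instance_def)
  show "hungry_valuation (V i)" if "i \<in> {1..n}"
    using assms that by (simp add: hungry_instance_def hungry_valuation_def)
  show "0 < w i" if "i \<in> {1..n}" using e that by (simp add: entitlements_def)
  show "sum w {1..n} = 1" using e by (simp add: entitlements_def)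
  then show "0 < n" by (cases n) auto
qed

lemma frontier_Icc_real: "a < b \<Longrightarrow> frontier {a..b::real} = {a, b}"
  by (auto simp: frontier_def)

text \<open>A one-point piece is worthless, so pieces have positive length. If two overlapped in
  more than an endpoint, the midpoint of the overlap would be interior to both, against the frontier
  condition.\<close>

lemma conn_strong_prop_pieces:
  assumes "hungry_instance n w V" "conn_strong_prop n w V X"
  obtains a b where
    "\<And>i. i \<in> {1..n} \<Longrightarrow> X i = {a i..b i} \<and> 0 \<le> a i \<and> a i < b i \<and> b i \<le> 1 \<and> w i < V i {a i..b i}"
    "\<And>i j. i \<in> {1..n} \<Longrightarrow> j \<in> {1..n} \<Longrightarrow> i \<noteq> j \<Longrightarrow> b i \<le> a j \<or> b j \<le> a i"
proof -
  have alloc: "allocation n X" and "\<forall>i\<in>{1..n}. \<exists>a b. a \<le> b \<and> X i = {a..b}"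
    and strong: "\<forall>i\<in>{1..n}. w i < V i (X i)"
    using assms(2) by (auto simp: conn_strong_prop_def connected_allocation_def strongly_proportional_def)
  then obtain a b where ab: "\<forall>i\<in>{1..n}. a i \<le> b i \<and> X i = {a i..b i}" by metis
  have sub: "X i \<subseteq> {0..1}" if "i \<in> {1..n}" for i
    using alloc that by (auto simp: allocation_def cake_def)
  have piece: "X i = {a i..b i} \<and> 0 \<le> a i \<and> a i < b i \<and> b i \<le> 1 \<and> w i < V i {a i..b i}"
    if i: "i \<in> {1..n}" for i
  proof -
    interpret hungry_valuation "V i" using hungry_instanceD(1)[OF assms(1) i] .
    have X: "X i = {a i..b i}" "a i \<le> b i" using ab i by auto
    then have r: "0 \<le> a i" "b i \<le> 1" using sub[OF i] by auto
    have "w i < V i {a i..b i}" using strong i X by metis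
    moreover have "a i \<noteq> b i"
    proof
      assume "a i = b i"
      then have "V i {a i..b i} = 0" using point[of "a i"] r by simp
      with \<open>w i < V i {a i..b i}\<close> hungry_instanceD(2)[OF assms(1) i] show False by simp
    qed
    ultimately show ?thesis using X r by simp
  qed
  have "b i \<le> a j \<or> b j \<le> a i" if ij: "i \<in> {1..n}" "j \<in> {1..n}" "i \<noteq> j" for i j
  proof (rule ccontr)
    assume "\<not> ?thesis"
    then have lt: "a j < b i" "a i < b j" by auto
    define m where "m = (max (a i) (a j) + min (b i) (b j)) / 2"
    have m: "a i < m" "a j < m" "m < b i" "m < b j"
      using lt piece[OF ij(1)] piece[OF ij(2)] by (auto simp: m_def)
    then have "m \<in> X i \<inter> X j" using piece[OF ij(1)] piece[OF ij(2)] by auto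
    then have "m \<in> frontier (X i)"
      using alloc ij unfolding allocation_def by blast
    then show False using m piece[OF ij(1)] by (auto simp: frontier_Icc_real)
  qed
  with piece show ?thesis by (rule that)
qed

text \<open>Induction in the order of right ends, with the sharper claim that the total length is at
  most one of these ends; the alternative \<open>0\<close> covers the empty set.\<close>

lemma sum_lengths_le_one:
  fixes a b :: "nat \<Rightarrow> real"
  assumes "finite S" "\<And>i. i \<in> S \<Longrightarrow> 0 \<le> a i \<and> a i < b i \<and> b i \<le> 1"
    "\<And>i j. i \<in> S \<Longrightarrow> j \<in> S \<Longrightarrow> i \<noteq> j \<Longrightarrow> b i \<le> a j \<or> b j \<le> a i"
  shows "(\<Sum>i\<in>S. b i - a i) \<le> 1"
proof -
  have "(\<Sum>i\<in>S. b i - a i) = 0 \<or> (\<exists>i\<in>S. (\<Sum>i\<in>S. b i - a i) \<le> b i)"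
    using assms
  proof (induction S rule: finite_ranking_induct[where f = b])
    case (insert x S)
    show ?case
    proof (cases "x \<in> S")
      case True
      with insert show ?thesis by (simp add: insert_absorb)
    next
      case False
      have "b i \<le> a x" if "i \<in> S" for i
        using insert.prems(1)[of i] insert.prems(1)[of x] insert.prems(2)[of i x]
          insert.hyps(2)[OF that] that False by auto
      moreover have "(\<Sum>i\<in>S. b i - a i) = 0 \<or> (\<exists>i\<in>S. (\<Sum>i\<in>S. b i - a i) \<le> b i)"
        using insert by auto
      moreover have "0 \<le> a x" using insert.prems(1)[of x] by simp
      ultimately have "(\<Sum>i\<in>S. b i - a i) \<le> a x" by fastforce
      then show ?thesis using False insert.hyps(1) by (simp add: algebra_simps)
    qed
  qed simp
  then show ?thesis using assms(2) by force
qed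

text \<open>Serve the agents by increasing right end of their pieces. Each piece is worth strictly
  more than the entitlement, so the sweep stays strictly left of the right end of an agent already
  served.\<close>

lemma ex_sweep_less_one:
  assumes "hungry_instance n w V" "conn_strong_prop n w V X"
  shows "\<exists>\<pi>. distinct \<pi> \<and> set \<pi> = {1..n} \<and> sweep V w \<pi> 0 < 1"
proof -
  obtain a b where
    ab: "\<And>i. i \<in> {1..n} \<Longrightarrow> X i = {a i..b i} \<and> 0 \<le> a i \<and> a i < b i \<and> b i \<le> 1 \<and> w i < V i {a i..b i}"
    and dis: "\<And>i j. i \<in> {1..n} \<Longrightarrow> j \<in> {1..n} \<Longrightarrow> i \<noteq> j \<Longrightarrow> b i \<le> a j \<or> b j \<le> a i"
    using conn_strong_prop_pieces[OF assms] by metis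
  have "S \<subseteq> {1..n} \<Longrightarrow> \<exists>\<pi>. distinct \<pi> \<and> set \<pi> = S \<and>
      (sweep V w \<pi> 0 = 0 \<or> (\<exists>i\<in>S. sweep V w \<pi> 0 < b i))" if "finite S" for S
    using that
  proof (induction S rule: finite_ranking_induct[where f = b])
    case empty
    show ?case by (intro exI[of _ "[]"]) auto
  next
    case (insert x S)
    then obtain \<pi> where \<pi>: "distinct \<pi>" "set \<pi> = S"
      "sweep V w \<pi> 0 = 0 \<or> (\<exists>i\<in>S. sweep V w \<pi> 0 < b i)" by auto
    show ?case
    proof (cases "x \<in> S")
      case True
      with \<pi> show ?thesis by (intro exI[of _ \<pi>]) auto
    next
      case False
      have x: "x \<in> {1..n}" using insert.prems by simp
      interpret hungry_valuation "V x" using hungry_instanceD(1)[OF assms(1) x] .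
      have "b i \<le> a x" if "i \<in> S" for i
        using ab[of i] ab[OF x] dis[of i x] insert.hyps(2)[OF that] insert.prems that False by force
      moreover have "0 \<le> a x" using ab[OF x] by simp
      ultimately have le: "sweep V w \<pi> 0 \<le> a x" using \<pi>(3) by fastforce
      have ge: "0 \<le> sweep V w \<pi> 0" by (rule sweep_bounds) auto
      have "V x {a x..b x} \<le> V x {sweep V w \<pi> 0..b x}"
        using le ge ab[OF x] by (intro Icc_mono) auto
      then have "cut_point (V x) (sweep V w \<pi> 0) (w x) < b x"
        using ge le ab[OF x] hungry_instanceD(2)[OF assms(1) x] by (intro cut_less) auto
      then show ?thesis
        using \<pi> False by (intro exI[of _ "\<pi> @ [x]"]) auto
    qed
  qed
  from this[of "{1..n}"] obtain \<pi> where \<pi>: "distinct \<pi>" "set \<pi> = {1..n}"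
    "sweep V w \<pi> 0 = 0 \<or> (\<exists>i\<in>{1..n}. sweep V w \<pi> 0 < b i)" by auto
  then have "sweep V w \<pi> 0 < 1" using ab by force
  with \<pi> show ?thesis by blast
qed

section \<open>Tilings of a right part of the cake\<close>

text \<open>The start \<open>a\<close> is a parameter because the pieces are built from right to
  left, which leaves \<open>[0,a]\<close> over until the end.\<close>

fun tiling :: "(nat \<Rightarrow> real set \<Rightarrow> real) \<Rightarrow> (nat \<Rightarrow> real) \<Rightarrow> nat list \<Rightarrow> real \<Rightarrow>
    (nat \<Rightarrow> real set) \<Rightarrow> bool" where
  "tiling V w [] a X \<longleftrightarrow> a = 1"
| "tiling V w (i # \<pi>) a X \<longleftrightarrow>
     (\<exists>b. a < b \<and> X i = {a..b} \<and> w i < V i {a..b} \<and> tiling V w \<pi> b X)"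

lemma tiling_upd: "i \<notin> set \<pi> \<Longrightarrow> tiling V w \<pi> a (X(i := Y)) \<longleftrightarrow> tiling V w \<pi> a X"
  by (induction \<pi> arbitrary: a) auto

lemma tiling_le_one: "tiling V w \<pi> a X \<Longrightarrow> a \<le> 1"
  by (induction \<pi> arbitrary: a) (auto intro: less_imp_le less_le_trans)

lemma tiling_Union:
  "tiling V w \<pi> a X \<Longrightarrow> \<pi> \<noteq> [] \<Longrightarrow> (\<Union>i\<in>set \<pi>. X i) = {a..1}"
proof (induction \<pi> arbitrary: a)
  case (Cons i \<pi>)
  then obtain b where b: "a < b" "X i = {a..b}" "tiling V w \<pi> b X" by auto
  show ?case
  proof (cases "\<pi> = []")
    case True
    with b show ?thesis by simp
  next
    case False
    then have "(\<Union>i\<in>set (i # \<pi>). X i) = {a..b} \<union> {b..1}" using Cons.IH[OF b(3)] b(2) by simp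
    with b(1) tiling_le_one[OF b(3)] show ?thesis by auto
  qed
qed simp

lemma tiling_pieces:
  "tiling V w \<pi> a X \<Longrightarrow> i \<in> set \<pi> \<Longrightarrow>
    \<exists>c d. a \<le> c \<and> c < d \<and> d \<le> 1 \<and> X i = {c..d} \<and> w i < V i {c..d}"
proof (induction \<pi> arbitrary: a)
  case (Cons j \<pi>)
  then obtain b where b: "a < b" "X j = {a..b}" "w j < V j {a..b}" "tiling V w \<pi> b X" by auto
  show ?case
  proof (cases "i = j")
    case True
    with b tiling_le_one[OF b(4)] show ?thesis by (intro exI[of _ a] exI[of _ b]) auto
  next
    case False
    then show ?thesis using Cons.IH[OF b(4)] Cons.prems b(1) by fastforce
  qed
qed simp

text \<open>Later pieces start at or after the end \<open>b\<close> of the first, so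
  \<open>b\<close> is the only possible common point, and then an endpoint of both.\<close>

lemma tiling_disjoint:
  "tiling V w \<pi> a X \<Longrightarrow> i \<in> set \<pi> \<Longrightarrow> j \<in> set \<pi> \<Longrightarrow> i \<noteq> j \<Longrightarrow>
    X i \<inter> X j \<subseteq> frontier (X i) \<inter> frontier (X j)"
proof (induction \<pi> arbitrary: a)
  case (Cons k \<pi>)
  then obtain b where b: "a < b" "X k = {a..b}" "tiling V w \<pi> b X" by auto
  have *: "X k \<inter> X j \<subseteq> frontier (X k) \<inter> frontier (X j)" if j: "j \<in> set \<pi>" for j
  proof -
    obtain c d where "b \<le> c" "c < d" "X j = {c..d}" using tiling_pieces[OF b(3) j] by auto
    with b show ?thesis by (auto simp: frontier_Icc_real)
  qed
  consider "i = k" "j \<in> set \<pi>" | "j = k" "i \<in> set \<pi>" | "i \<in> set \<pi>" "j \<in> set \<pi>"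
    using Cons.prems by auto
  then show ?case
    by cases (use *[of i] *[of j] Cons.IH[OF b(3)] Cons.prems(4) in blast)+
qed simp

lemma tiling_conn_strong_prop:
  assumes "tiling V w \<pi> 0 X" "set \<pi> = {1..n}" "0 < n"
  shows "conn_strong_prop n w V X"
proof -
  have piece: "\<exists>c d. 0 \<le> c \<and> c < d \<and> d \<le> 1 \<and> X i = {c..d} \<and> w i < V i {c..d}"
    if "i \<in> {1..n}" for i using tiling_pieces[OF assms(1)] that assms(2) by blast
  have "\<pi> \<noteq> []" using assms(2,3) by auto
  then have un: "(\<Union>i\<in>{1..n}. X i) = cake"
    using tiling_Union[OF assms(1)] assms(2) by (simp add: cake_def)
  have "allocation n X"
    unfolding allocation_def
  proof (intro conjI ballI impI)
    fix i assume "i \<in> {1..n}"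
    then obtain c d where "X i = {c..d}" using piece by blast
    then show "\<exists>F. finite F \<and> (\<forall>I\<in>F. \<exists>a b. I = {a..b}) \<and> X i = \<Union>F"
      by (intro exI[of _ "{{c..d}}"]) auto
  next
    show "(\<Union>i\<in>{1..n}. X i) = cake" by (rule un)
  next
    fix i j assume "i \<in> {1..n}" "j \<in> {1..n}" "i \<noteq> j"
    then show "X i \<inter> X j \<subseteq> frontier (X i) \<inter> frontier (X j)"
      using tiling_disjoint[OF assms(1)] assms(2) by blast
  qed
  then show ?thesis
    unfolding conn_strong_prop_def connected_allocation_def strongly_proportional_def
    using piece by (metis less_imp_le)
qed

section \<open>Upper bound\<close>

text \<open>Each agent first marks its entitlement starting from \<open>z\<close>; this leaves slack at the right end
  of the cake. The slack is then passed on from right to left: an agent whose piece exceeds the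
  entitlement by \<open>s\<close> gives up a left part of value \<open>s / 2\<close> to its left neighbour. The maxima only
  ensure legality on branches that no valuation produces.\<close>

primrec assign :: "(nat \<Rightarrow> real) \<Rightarrow> nat list \<Rightarrow> real \<Rightarrow>
    (real \<Rightarrow> (nat \<Rightarrow> real set) \<Rightarrow> 'a protocol) \<Rightarrow> 'a protocol" where
  "assign w [] z k = k 1 (\<lambda>_. {})"
| "assign w (i # \<pi>) z k = Mark i z (w i) (\<lambda>c. assign w \<pi> (clip c) (\<lambda>b X.
     Eval i z (max z b) (\<lambda>e. Mark i z (max 0 ((e - w i) / 2)) (\<lambda>m.
       k (clip m) (X(i := {clip m..b}))))))"

lemma legal_assign:
  assumes "\<And>b X. 0 \<le> b \<Longrightarrow> b \<le> 1 \<Longrightarrow> legal n (k b X)"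
    "set \<pi> \<subseteq> {1..n}" "\<And>i. i \<in> set \<pi> \<Longrightarrow> 0 \<le> w i" "0 \<le> z" "z \<le> 1"
  shows "legal n (assign w \<pi> z k)"
  using assms
proof (induction \<pi> arbitrary: z k)
  case (Cons i \<pi>)
  show ?case
    using Cons.prems clip_bounds
    by (auto simp: cake_def intro!: Cons.IH)
qed simp

text \<open>\<open>b\<close> and \<open>X\<close> do not depend on \<open>k\<close>, since the
  induction instantiates \<open>k\<close> with the remaining queries of the current agent. The
  factor \<open>3\<close> counts its two marks and one evaluation.\<close>

lemma assign_correct:
  assumes "\<And>i. i \<in> set \<pi> \<Longrightarrow> hungry_valuation (V i) \<and> 0 < w i" "distinct \<pi>"
    "0 \<le> z" "z \<le> 1" "sweep V w \<pi> z < 1"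
  shows "\<exists>b X. z < b \<and> tiling V w \<pi> b X \<and>
    (\<forall>k :: real \<Rightarrow> (nat \<Rightarrow> real set) \<Rightarrow> 'a protocol. run V (assign w \<pi> z k) = run V (k b X) \<and>
      queries V (assign w \<pi> z k) = 3 * length \<pi> + queries V (k b X))"
  using assms
proof (induction \<pi> arbitrary: z)
  case Nil
  then show ?case by auto
next
  case (Cons i \<pi>)
  interpret hungry_valuation "V i" using Cons.prems(1) by simp
  have w: "0 < w i" using Cons.prems(1) by simp
  define c where "c = cut_point (V i) z (w i)"
  have c01: "0 \<le> c" "c \<le> 1" by (simp_all add: c_def cut_point_bounds)
  have c1: "sweep V w \<pi> c < 1" using Cons.prems(5) by (simp add: c_def)
  obtain b X where b: "c < b" "tiling V w \<pi> b X" and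
    k: "\<And>k :: real \<Rightarrow> (nat \<Rightarrow> real set) \<Rightarrow> 'a protocol. run V (assign w \<pi> c k) = run V (k b X) \<and>
      queries V (assign w \<pi> c k) = 3 * length \<pi> + queries V (k b X)"
    using Cons.IH[of c] Cons.prems(1,2) c01 c1 by (metis distinct.simps(2) list.set_intros(2))
  have b1: "b \<le> 1" using tiling_le_one[OF b(2)] .
  have "c < 1" using b(1) b1 by simp
  then have vc: "V i {z..c} = w i" and zc: "z \<le> c"
    using value_cut'[of z "w i"] cut_ge[of z "w i"] Cons.prems(3,4) w by (simp_all add: c_def)
  \<comment> \<open>The agents after \<open>i\<close> have given up \<open>[c,b]\<close>, so
    \<open>i\<close> can now hold more than \<open>w i\<close>.\<close>
  define e where "e = V i {z..b}"
  have e: "w i < e"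
    using split[of z c b] vc zc b(1) b1 Icc_pos[of c b] Cons.prems(3) by (simp add: e_def)
  define m where "m = cut_point (V i) z ((e - w i) / 2)"
  have mb: "m < b"
    unfolding m_def using e w zc b b1 Cons.prems(3) by (intro cut_less) (auto simp: e_def)
  have vm: "V i {z..m} = (e - w i) / 2" and zm: "z \<le> m"
    using value_cut'[of z "(e - w i) / 2"] cut_ge[of z "(e - w i) / 2"] Cons.prems(3,4) e mb b1
    by (simp_all add: m_def)
  have "z \<noteq> m" using vm e point[of z] Cons.prems(3,4) by auto
  then have "z < m" using zm by simp
  \<comment> \<open>After half of the surplus is given up, \<open>(e + w i) / 2\<close>
    remains.\<close>
  moreover have "w i < V i {m..b}"
    using split[of z m b] vm e mb zm b1 Cons.prems(3) by (simp add: e_def field_simps)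
  then have "tiling V w (i # \<pi>) m (X(i := {m..b}))"
    using mb b(2) Cons.prems(2) by (auto simp: tiling_upd)
  moreover have "run V (assign w (i # \<pi>) z k) = run V (k m (X(i := {m..b}))) \<and>
      queries V (assign w (i # \<pi>) z k) = 3 * length (i # \<pi>) + queries V (k m (X(i := {m..b})))"
    for k :: "real \<Rightarrow> (nat \<Rightarrow> real set) \<Rightarrow> 'a protocol"
    using k zc b(1) e
    by (simp add: eval_query_def e_def[symmetric] c_def[symmetric, unfolded cut_point_def]
        m_def[symmetric, unfolded cut_point_def] max_def)
  ultimately show ?case by blast
qed

text \<open>The first agent has no left neighbour, so it absorbs the slack that arrives at the left
  end.\<close>

definition finish :: "nat list \<Rightarrow> real \<Rightarrow> (nat \<Rightarrow> real set) \<Rightarrow> nat \<Rightarrow> real set" where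
  "finish \<pi> b X = X(hd \<pi> := {0..b} \<union> X (hd \<pi>))"

lemma finish_conn_strong_prop:
  assumes "hungry_instance n w V" "distinct \<pi>" "set \<pi> = {1..n}" "0 < b" "tiling V w \<pi> b X"
  shows "conn_strong_prop n w V (finish \<pi> b X)"
proof -
  have n: "0 < n" using hungry_instanceD(4)[OF assms(1)] .
  then obtain i \<rho> where \<pi>: "\<pi> = i # \<rho>" using assms(3) by (cases \<pi>) auto
  have i: "i \<in> {1..n}" using assms(3) \<pi> by auto
  interpret hungry_valuation "V i" using hungry_instanceD(1)[OF assms(1) i] .
  obtain c where c: "b < c" "X i = {b..c}" "w i < V i {b..c}" "tiling V w \<rho> c X"
    using assms(5) \<pi> by auto
  have c1: "c \<le> 1" using tiling_le_one[OF c(4)] .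
  have "{0..b} \<union> {b..c} = {0..c}" using assms(4) c(1) by auto
  then have X: "finish \<pi> b X = X(i := {0..c})" using c \<pi> by (simp add: finish_def)
  have "V i {b..c} \<le> V i {0..c}" using assms(4) c c1 by (intro Icc_mono) auto
  then have "tiling V w \<pi> 0 (finish \<pi> b X)"
    unfolding X using \<pi> c assms(2,4) by (auto simp: tiling_upd)
  then show ?thesis using tiling_conn_strong_prop assms(3) n by blast
qed

text \<open>From right to left, \<open>assign_correct\<close> supplies the tiling obtained by
  passing the slack leftward; the converse is \<open>ex_sweep_less_one\<close>.\<close>

lemma conn_strong_prop_iff_sweep:
  assumes "hungry_instance n w V"
  shows "(\<exists>X. conn_strong_prop n w V X) \<longleftrightarrow>
    (\<exists>\<pi>. distinct \<pi> \<and> set \<pi> = {1..n} \<and> sweep V w \<pi> 0 < 1)"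
proof
  assume "\<exists>\<pi>. distinct \<pi> \<and> set \<pi> = {1..n} \<and> sweep V w \<pi> 0 < 1"
  then obtain \<pi> where \<pi>: "distinct \<pi>" "set \<pi> = {1..n}" "sweep V w \<pi> 0 < 1" by blast
  obtain b X where "0 < b" "tiling V w \<pi> b X"
    using assign_correct[of \<pi> V w 0] \<pi> hungry_instanceD(1,2)[OF assms] by auto
  then show "\<exists>X. conn_strong_prop n w V X"
    using finish_conn_strong_prop[OF assms \<pi>(1,2)] by blast
qed (use ex_sweep_less_one[OF assms] in blast)

section \<open>Dynamic program over sets of agents\<close>

text \<open>A table maps a set of agents to the end of a sweep from \<open>0\<close> and the order in which that sweep
  serves the set; an entry with end \<open>1\<close> carries no order. A pair \<open>(S, i)\<close> in the list of \<open>dp\<close> stands for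
  the attempt to serve \<open>i\<close> last among \<open>S\<close>.\<close>

type_synonym table = "nat set \<Rightarrow> real \<times> nat list"

text \<open>With entries at most \<open>1\<close>, the strict comparison records only ends below
  \<open>1\<close>, so a failed attempt never overwrites an entry.\<close>

definition improve :: "nat set \<Rightarrow> nat \<Rightarrow> real \<Rightarrow> table \<Rightarrow> table" where
  "improve S i c t = (if c < fst (t S) then t(S := (c, snd (t (S - {i})) @ [i])) else t)"

primrec dp :: "(nat \<Rightarrow> real) \<Rightarrow> (nat set \<times> nat) list \<Rightarrow> table \<Rightarrow> (table \<Rightarrow> 'a protocol) \<Rightarrow> 'a protocol"
  where
  "dp w [] t k = k t"
| "dp w (p # L) t k = Mark (snd p) (fst (t (fst p - {snd p}))) (w (snd p))
     (\<lambda>c. dp w L (improve (fst p) (snd p) (clip c) t) k)"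

primrec dp_table :: "(nat \<Rightarrow> real set \<Rightarrow> real) \<Rightarrow> (nat \<Rightarrow> real) \<Rightarrow> (nat set \<times> nat) list \<Rightarrow> table \<Rightarrow> table"
  where
  "dp_table V w [] t = t"
| "dp_table V w (p # L) t = dp_table V w L
     (improve (fst p) (snd p) (cut_point (V (snd p)) (fst (t (fst p - {snd p}))) (w (snd p))) t)"

lemma run_dp: "run V (dp w L t k) = run V (k (dp_table V w L t))"
  by (induction L arbitrary: t) (simp_all add: cut_point_def)

lemma queries_dp: "queries V (dp w L t k) = length L + queries V (k (dp_table V w L t))"
  by (induction L arbitrary: t) (simp_all add: cut_point_def)

text \<open>Legality must hold for arbitrary answers. The invariant keeps the start of every mark
  query in the cake and the stored orders within \<open>{1..n}\<close>, as \<open>assign\<close>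
  requires.\<close>

lemma legal_dp:
  assumes "\<And>t. (\<forall>S. 0 \<le> fst (t S) \<and> fst (t S) \<le> 1 \<and> set (snd (t S)) \<subseteq> {1..n}) \<Longrightarrow> legal n (k t)"
    "\<forall>S. 0 \<le> fst (t S) \<and> fst (t S) \<le> 1 \<and> set (snd (t S)) \<subseteq> {1..n}"
    "\<And>p. p \<in> set L \<Longrightarrow> snd p \<in> {1..n}" "\<And>i. i \<in> {1..n} \<Longrightarrow> 0 \<le> w i"
  shows "legal n (dp w L t k)"
  using assms(2,3)
proof (induction L arbitrary: t)
  case Nil
  then show ?case using assms(1) by simp
next
  case (Cons p L)
  have "legal n (dp w L (improve (fst p) (snd p) (clip c) t) k)" for c
    using Cons.prems by (intro Cons.IH) (auto simp: improve_def clip_bounds)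
  then show ?case using Cons.prems assms(4) by (auto simp: cake_def)
qed

lemma dp_table_le: "fst (dp_table V w L t S) \<le> fst (t S)"
proof (induction L arbitrary: t)
  case (Cons p L)
  have "fst (improve (fst p) (snd p) c t S) \<le> fst (t S)" for c
    by (simp add: improve_def)
  then show ?case unfolding dp_table.simps by (rule order_trans[OF Cons])
qed simp

lemma dp_table_unchanged: "S \<notin> fst ` set L \<Longrightarrow> dp_table V w L t S = t S"
  by (induction L arbitrary: t) (auto simp: improve_def)

text \<open>Sets come in order of size, so the entry of \<open>S - {i}\<close> is final when
  \<open>(S, i)\<close> is treated; afterwards the entry of \<open>S\<close> can only
  decrease.\<close>

lemma dp_table_step:
  assumes "sorted (map (\<lambda>p. card (fst p)) L)" "\<And>p. p \<in> set L \<Longrightarrow> finite (fst p) \<and> snd p \<in> fst p"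
    "(S, i) \<in> set L"
  shows "fst (dp_table V w L t S)
    \<le> cut_point (V i) (fst (dp_table V w L t (S - {i}))) (w i)"
  using assms
proof (induction L arbitrary: t)
  case (Cons p L)
  define t' where "t' = improve (fst p) (snd p)
    (cut_point (V (snd p)) (fst (t (fst p - {snd p}))) (w (snd p))) t"
  have t': "dp_table V w (p # L) t = dp_table V w L t'" by (simp add: t'_def)
  show ?case
  proof (cases "(S, i) = p")
    case True
    then have S: "finite S" "i \<in> S" using Cons.prems(2)[of p] by auto
    have "fst (dp_table V w L t' S) \<le> fst (t' S)" by (rule dp_table_le)
    also have "\<dots> \<le> cut_point (V i) (fst (t (S - {i}))) (w i)"
      using True by (auto simp: t'_def improve_def)
    also have "t (S - {i}) = t' (S - {i})"
    proof -
      have "S - {i} \<noteq> S" using S by blast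
      then show ?thesis by (simp add: t'_def improve_def True[symmetric])
    qed
    also have "\<dots> = dp_table V w L t' (S - {i})"
    proof -
      have "card (S - {i}) < card S" using S by (meson card_Diff1_less)
      moreover have "card S \<le> card (fst q)" if "q \<in> set L" for q
        using Cons.prems(1) True that by auto
      ultimately have "S - {i} \<notin> fst ` set L" by force
      then show ?thesis by (simp add: dp_table_unchanged)
    qed
    finally show ?thesis unfolding t' .
  next
    case False
    then show ?thesis unfolding t' using Cons.prems by (intro Cons.IH) auto
  qed
qed simp

text \<open>One half of correctness: entries below \<open>1\<close> are attained by a sweep. The
  other half is \<open>dp_table_minimal\<close>.\<close>

definition sound_table :: "(nat \<Rightarrow> real set \<Rightarrow> real) \<Rightarrow> (nat \<Rightarrow> real) \<Rightarrow> table \<Rightarrow> bool" where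
  "sound_table V w t \<longleftrightarrow> (\<forall>S. fst (t S) \<ge> 0 \<and> fst (t S) \<le> 1 \<and> (fst (t S) < 1 \<longrightarrow>
     distinct (snd (t S)) \<and> set (snd (t S)) = S \<and> sweep V w (snd (t S)) 0 = fst (t S)))"

lemma sound_dp_table:
  assumes "sound_table V w t" "\<And>p. p \<in> set L \<Longrightarrow> snd p \<in> fst p"
    "\<And>p. p \<in> set L \<Longrightarrow> hungry_valuation (V (snd p)) \<and> 0 \<le> w (snd p)"
  shows "sound_table V w (dp_table V w L t)"
  using assms
proof (induction L arbitrary: t)
  case (Cons p L)
  obtain S i where p: "p = (S, i)" by (cases p)
  interpret hungry_valuation "V i" using Cons.prems(3)[of p] p by simp
  define x where "x = fst (t (S - {i}))"
  define c where "c = cut_point (V i) x (w i)"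
  have "sound_table V w (improve S i c t)"
  proof (cases "c < fst (t S)")
    case True
    have x01: "0 \<le> x" "x \<le> 1" using Cons.prems(1) by (auto simp: sound_table_def x_def)
    have "fst (t S) \<le> 1" using Cons.prems(1) by (simp add: sound_table_def)
    then have "c < 1" using True by simp
    \<comment> \<open>A cut never lies left of its start, so \<open>x < 1\<close> and the order
      stored for \<open>S - {i}\<close> is meaningful.\<close>
    then have "x < 1" using cut_ge[OF x01, of "w i"] Cons.prems(3)[of p] p by (simp add: c_def)
    then have "distinct (snd (t (S - {i})))" "set (snd (t (S - {i}))) = S - {i}"
      "sweep V w (snd (t (S - {i}))) 0 = x"
      using Cons.prems(1) by (auto simp: sound_table_def x_def)
    then have "distinct (snd (t (S - {i})) @ [i])" "set (snd (t (S - {i})) @ [i]) = S"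
      "sweep V w (snd (t (S - {i})) @ [i]) 0 = c"
      using Cons.prems(2)[of p] p by (auto simp: c_def)
    then show ?thesis
      using True Cons.prems(1) cut_point_bounds[of "V i" x "w i"]
      by (auto simp: sound_table_def improve_def c_def[symmetric])
  next
    case False
    then show ?thesis using Cons.prems(1) by (simp add: improve_def)
  qed
  then show ?case using Cons.prems by (simp add: p c_def x_def Cons.IH)
qed simp

definition initial_table :: table where
  "initial_table S = (if S = {} then 0 else 1, [])"

lemma initial_table_empty: "fst (initial_table {}) = 0"
  by (simp add: initial_table_def)

lemma initial_table_range:
  "\<forall>S. 0 \<le> fst (initial_table S) \<and> fst (initial_table S) \<le> 1 \<and> set (snd (initial_table S)) \<subseteq> {1..n}"
  by (simp add: initial_table_def)

lemma sound_initial_table: "sound_table V w initial_table"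
  by (auto simp: sound_table_def initial_table_def)

lemma sound_dp_initial_table:
  assumes "set L = {(S, i). S \<subseteq> {1..n} \<and> i \<in> S}" "hungry_instance n w V"
  shows "sound_table V w (dp_table V w L initial_table)"
proof (rule sound_dp_table[OF sound_initial_table])
  fix p assume p: "p \<in> set L"
  then show "snd p \<in> fst p" using assms(1) by auto
  have "snd p \<in> {1..n}" using p assms(1) by auto
  then show "hungry_valuation (V (snd p)) \<and> 0 \<le> w (snd p)"
    using hungry_instanceD(1,2)[OF assms(2)] by (simp add: less_imp_le)
qed

text \<open>Remove the agent served last: the entry is at most the cut from the entry of the others,
  which \<open>cut_mono\<close> compares with the cut from their sweep.\<close>

lemma dp_table_minimal:
  assumes "sorted (map (\<lambda>p. card (fst p)) L)" "set L = {(S, i). S \<subseteq> {1..n} \<and> i \<in> S}"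
    "hungry_instance n w V" "distinct \<pi>" "set \<pi> \<subseteq> {1..n}"
  shows "fst (dp_table V w L initial_table (set \<pi>)) \<le> sweep V w \<pi> 0"
  using assms(4,5)
proof (induction \<pi> rule: rev_induct)
  case Nil
  show ?case using dp_table_le[of V w L initial_table "{}"] by (simp add: initial_table_empty)
next
  case (snoc i \<pi>)
  let ?T = "dp_table V w L initial_table"
  have i: "i \<in> {1..n}" using snoc.prems by simp
  interpret hungry_valuation "V i" using hungry_instanceD(1)[OF assms(3) i] .
  have S: "set (\<pi> @ [i]) - {i} = set \<pi>" using snoc.prems by auto
  have fin: "finite (fst p) \<and> snd p \<in> fst p" if "p \<in> set L" for p
    using that assms(2) finite_subset[of "fst p" "{1..n}"] by auto
  have T: "0 \<le> fst (?T (set \<pi>))"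
    using sound_dp_initial_table[OF assms(2,3)] by (simp add: sound_table_def)
  have "fst (?T (set (\<pi> @ [i]))) \<le> cut_point (V i) (fst (?T (set (\<pi> @ [i]) - {i}))) (w i)"
    using snoc.prems assms(2) by (intro dp_table_step[OF assms(1)] fin) auto
  also have "\<dots> \<le> cut_point (V i) (sweep V w \<pi> 0) (w i)"
    unfolding S using snoc T hungry_instanceD(2)[OF assms(3) i] sweep_bounds[of 0 V w \<pi>]
    by (intro cut_mono) auto
  finally show ?case by simp
qed

text \<open>The bound is crude, from inclusion in a product; there are exactly
  \<open>n * 2 ^ (n - 1)\<close> such pairs.\<close>

lemma ex_visiting_order:
  "\<exists>L. sorted (map (\<lambda>p. card (fst p)) L) \<and> set L = {(S, i). S \<subseteq> {1..n} \<and> i \<in> S} \<and>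
     length L \<le> n * 2 ^ n"
proof -
  let ?P = "{(S, i). S \<subseteq> {1..n::nat} \<and> i \<in> S}"
  have sub: "?P \<subseteq> Pow {1..n} \<times> {1..n}" by auto
  then have "finite ?P" by (rule finite_subset) auto
  from finite_distinct_list[OF this] obtain L where L: "set L = ?P" "distinct L" by (elim exE conjE)
  have "card ?P \<le> card (Pow {1..n} \<times> {1..n})" using sub by (intro card_mono) auto
  then have "length L \<le> n * 2 ^ n"
    using L distinct_card[OF L(2)] by (simp add: card_cartesian_product card_Pow mult.commute)
  then show ?thesis
    using L by (intro exI[of _ "sort_key (\<lambda>p. card (fst p)) L"]) auto
qed

section \<open>Upper bounds on the query complexities\<close>

lemma query_complexity_le:
  assumes "\<And>w. legal n (A w)" "\<And>w V. (w, V) \<in> D \<Longrightarrow> R w V (run V (A w))"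
    "\<And>w V. (w, V) \<in> D \<Longrightarrow> queries V (A w) \<le> N"
  shows "query_complexity n D R \<le> enat N"
  unfolding query_complexity_def
  by (rule INF_lower2[of A]) (use assms in \<open>auto intro!: SUP_least\<close>)

lemma entitlementsD: "entitlements n w \<Longrightarrow> i \<in> {1..n} \<Longrightarrow> 0 < w i"
  by (simp add: entitlements_def)

lemma decision_complexity_le: "decision_complexity n \<le> enat (n * 2 ^ n)"
proof -
  obtain L where L: "sorted (map (\<lambda>p. card (fst p)) L)"
    "set L = {(S, i). S \<subseteq> {1..n} \<and> i \<in> S}" "length L \<le> n * 2 ^ n"
    using ex_visiting_order by blast
  \<comment> \<open>A legal protocol is required for every \<open>w\<close>, so a \<open>w\<close>
    that is no entitlement vector gets one without queries.\<close>
  define A where "A w = (if entitlements n w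
    then dp w L initial_table (\<lambda>t. Return (fst (t {1..n}) < 1)) else Return undefined)" for w
  show ?thesis unfolding decision_complexity_def
  proof (rule query_complexity_le[of _ A])
    fix w
    show "legal n (A w)"
    proof (cases "entitlements n w")
      case True
      have "legal n (dp w L initial_table (\<lambda>t. Return (fst (t {1..n}) < 1)))"
        by (rule legal_dp[OF _ initial_table_range])
           (use L(2) entitlementsD[OF True] in \<open>auto intro: less_imp_le\<close>)
      then show ?thesis using True by (simp add: A_def)
    qed (simp add: A_def)
  next
    fix w V assume "(w, V) \<in> {(w, V). hungry_instance n w V}"
    then have H: "hungry_instance n w V" by simp
    then have e: "entitlements n w" by (simp add: hungry_instance_def)
    let ?T = "dp_table V w L initial_table"
    show "queries V (A w) \<le> n * 2 ^ n" using e L(3) by (simp add: A_def queries_dp)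
    have sound: "sound_table V w ?T" by (rule sound_dp_initial_table[OF L(2) H])
    have "fst (?T {1..n}) < 1 \<longleftrightarrow> (\<exists>\<pi>. distinct \<pi> \<and> set \<pi> = {1..n} \<and> sweep V w \<pi> 0 < 1)"
    proof
      assume "fst (?T {1..n}) < 1"
      then show "\<exists>\<pi>. distinct \<pi> \<and> set \<pi> = {1..n} \<and> sweep V w \<pi> 0 < 1"
        using sound unfolding sound_table_def by metis
    next
      assume "\<exists>\<pi>. distinct \<pi> \<and> set \<pi> = {1..n} \<and> sweep V w \<pi> 0 < 1"
      then show "fst (?T {1..n}) < 1"
        using dp_table_minimal[OF L(1,2) H] by (metis le_less_trans order_refl)
    qed
    then show "run V (A w) \<longleftrightarrow> (\<exists>X. conn_strong_prop n w V X)"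
      using e by (simp add: A_def run_dp conn_strong_prop_iff_sweep[OF H])
  qed
qed

text \<open>The table is followed by \<open>assign\<close> on the order stored for all agents, at
  three queries per agent.\<close>

lemma search_complexity_le: "search_complexity n \<le> enat (n * 2 ^ n + 3 * n)"
proof -
  obtain L where L: "sorted (map (\<lambda>p. card (fst p)) L)"
    "set L = {(S, i). S \<subseteq> {1..n} \<and> i \<in> S}" "length L \<le> n * 2 ^ n"
    using ex_visiting_order by blast
  define K :: "(nat \<Rightarrow> real) \<Rightarrow> table \<Rightarrow> (nat \<Rightarrow> real set) protocol" where
    "K w t = assign w (snd (t {1..n})) 0 (\<lambda>b X. Return (finish (snd (t {1..n})) b X))" for w t
  define A where "A w = (if entitlements n w
    then dp w L initial_table (K w) else Return undefined)" for w
  show ?thesis unfolding search_complexity_def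
  proof (rule query_complexity_le[of _ A])
    fix w
    show "legal n (A w)"
    proof (cases "entitlements n w")
      case True
      have "legal n (K w t)" if "set (snd (t {1..n})) \<subseteq> {1..n}" for t
        unfolding K_def
      proof (rule legal_assign)
        fix i assume "i \<in> set (snd (t {1..n}))"
        then show "0 \<le> w i" using that entitlementsD[OF True] by (meson less_imp_le subsetD)
      qed (use that in auto)
      then have "legal n (dp w L initial_table (K w))"
        by (intro legal_dp[OF _ initial_table_range])
           (use L(2) entitlementsD[OF True] in \<open>auto intro: less_imp_le\<close>)
      then show ?thesis using True by (simp add: A_def)
    qed (simp add: A_def)
  next
    fix w V
    assume "(w, V) \<in> {(w, V). hungry_instance n w V \<and> (\<exists>X. conn_strong_prop n w V X)}"
    then have H: "hungry_instance n w V" and ex: "\<exists>X. conn_strong_prop n w V X" by simp_all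
    then have e: "entitlements n w" by (simp add: hungry_instance_def)
    let ?T = "dp_table V w L initial_table"
    define \<pi> where "\<pi> = snd (?T {1..n})"
    have sound: "sound_table V w ?T" by (rule sound_dp_initial_table[OF L(2) H])
    have "fst (?T {1..n}) < 1"
      using dp_table_minimal[OF L(1,2) H] ex unfolding conn_strong_prop_iff_sweep[OF H]
      by (metis le_less_trans order_refl)
    then have \<pi>: "distinct \<pi>" "set \<pi> = {1..n}" "sweep V w \<pi> 0 < 1"
      using sound unfolding sound_table_def \<pi>_def by metis+
    obtain b X where b: "0 < b" "tiling V w \<pi> b X" and
      k: "\<And>k :: real \<Rightarrow> (nat \<Rightarrow> real set) \<Rightarrow> (nat \<Rightarrow> real set) protocol.
        run V (assign w \<pi> 0 k) = run V (k b X) \<and>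
        queries V (assign w \<pi> 0 k) = 3 * length \<pi> + queries V (k b X)"
      using assign_correct[of \<pi> V w 0] \<pi> hungry_instanceD(1,2)[OF H] by auto
    have "length \<pi> = n" using \<pi> distinct_card by fastforce
    moreover have K: "K w ?T = assign w \<pi> 0 (\<lambda>b X. Return (finish \<pi> b X))"
      unfolding K_def \<pi>_def ..
    ultimately show "queries V (A w) \<le> n * 2 ^ n + 3 * n"
      using e L(3) k by (simp add: A_def queries_dp)
    show "conn_strong_prop n w V (run V (A w))"
      using e k finish_conn_strong_prop[OF H \<pi>(1,2) b]
      by (simp add: A_def run_dp K)
  qed
qed

section \<open>Lower bound\<close>

text \<open>For \<open>d \<ge> 0\<close>, the measure with density \<open>3/2\<close> on
  \<open>[p-d,p]\<close>, \<open>1/2\<close> on \<open>[p,p+d]\<close> and \<open>1\<close>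
  elsewhere; \<open>bump 0 0\<close> is the uniform valuation.\<close>

definition bump :: "real \<Rightarrow> real \<Rightarrow> real set \<Rightarrow> real" where
  "bump p d X = measure lborel X
     + (measure lborel (X \<inter> {p - d..p}) - measure lborel (X \<inter> {p..p + d})) / 2"

text \<open>For \<open>0 \<le> d \<le> p\<close> and \<open>0 \<le> x\<close>, this is the excess of
  \<open>bump p d {0..x}\<close> over \<open>x\<close>; its peak is \<open>d / 2\<close>, at
  \<open>p\<close>.\<close>

definition tent :: "real \<Rightarrow> real \<Rightarrow> real \<Rightarrow> real" where
  "tent p d x = max 0 (d - \<bar>x - p\<bar>) / 2"

lemma bump_Icc:
  assumes "0 \<le> d" "x \<le> y"
  shows "bump p d {x..y} = y - x + (tent p d y - tent p d x)"
proof -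
  have m: "measure lborel {l..u} = max 0 (u - l)" for l u :: real
    by (cases "l \<le> u") auto
  show ?thesis
    using assms unfolding bump_def tent_def Int_atLeastAtMost m
    by (simp add: max_def min_def abs_if field_simps)
qed

lemma emeasure_lborel_cake_subset:
  assumes "X \<subseteq> cake" shows "emeasure lborel X \<noteq> \<infinity>"
proof -
  have "emeasure lborel X \<le> emeasure lborel cake"
    using assms by (intro emeasure_mono) (auto simp: cake_def)
  also have "\<dots> = 1" by (simp add: cake_def)
  finally show ?thesis by (auto simp: top_unique)
qed

lemma measure_Int_le:
  assumes "X \<in> sets lborel" "X \<subseteq> cake"
  shows "measure lborel (X \<inter> {a..b::real}) \<le> measure lborel X"
  using assms emeasure_lborel_cake_subset[OF assms(2)]
  by (intro measure_mono_fmeasurable fmeasurableI) (auto simp: top.not_eq_extremum)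

text \<open>At most half of the measure of \<open>X\<close> is subtracted. The bound yields both
  nonnegativity and hungriness.\<close>

lemma bump_ge_half:
  assumes "X \<in> sets lborel" "X \<subseteq> cake"
  shows "measure lborel X / 2 \<le> bump p d X"
proof -
  have "c / 2 \<le> c + (a - b) / 2" if "b \<le> c" "0 \<le> a" for a b c :: real
    using that by (simp add: field_simps)
  then show ?thesis unfolding bump_def using measure_Int_le[OF assms] by (simp only: measure_nonneg)
qed

lemma additive_bump: "additive cake_algebra (bump p d)"
  unfolding additive_def
proof (intro ballI impI)
  fix X Y assume XY: "X \<in> cake_algebra" "Y \<in> cake_algebra" "X \<inter> Y = {}"
  note X = cake_algebra_borel[OF XY(1)] and Y = cake_algebra_borel[OF XY(2)]
  have "measure lborel (X \<union> Y) = measure lborel X + measure lborel Y"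
    using X Y XY(3) by (intro measure_Union emeasure_lborel_cake_subset)
  moreover have "measure lborel ((X \<union> Y) \<inter> {a..b})
      = measure lborel (X \<inter> {a..b}) + measure lborel (Y \<inter> {a..b})" for a b
    unfolding Int_Un_distrib2
    using X Y XY(3) by (intro measure_Union emeasure_lborel_cake_subset) auto
  ultimately show "bump p d (X \<union> Y) = bump p d X + bump p d Y"
    unfolding bump_def by (simp add: field_simps)
qed

text \<open>The bounds keep the tent inside the cake, so gain and loss cancel and the total value is
  \<open>1\<close>.\<close>

lemma hungry_valuation_bump:
  assumes "0 \<le> d" "d \<le> p" "p + d \<le> 1"
  shows "hungry_valuation (bump p d)"
proof
  have "continuous_on cake (\<lambda>x. x + (tent p d x - tent p d 0))"
    unfolding tent_def by (intro continuous_intros) auto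
  then have "continuous_on cake (\<lambda>x. bump p d {0..x})"
    by (rule continuous_on_eq) (use assms in \<open>auto simp: cake_def bump_Icc\<close>)
  moreover have "bump p d {0} = 0" using bump_Icc[of d 0 0 p] assms by simp
  moreover have "bump p d cake = 1"
    using assms unfolding cake_def by (subst bump_Icc) (auto simp: tent_def max_def)
  moreover have "0 \<le> bump p d X" if "X \<in> cake_algebra" for X
    using bump_ge_half[OF cake_algebra_borel[OF that], of p d] measure_nonneg[of lborel X] by linarith
  ultimately show "valuation (bump p d)"
    unfolding valuation_def using additive_bump by blast
  show "hungry (bump p d)"
    unfolding hungry_def
  proof (intro allI impI)
    fix X :: "real set" assume X: "is_interval X \<and> X \<subseteq> cake \<and> 0 < measure lborel X"
    then have "X \<in> cake_algebra" by (simp add: interval_in_cake_algebra)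
    then show "0 < bump p d X" using bump_ge_half[OF cake_algebra_borel, of X p d] X by simp
  qed
qed

lemma tent_nonneg: "0 \<le> tent p d x"
  by (simp add: tent_def)

lemma tent_eq_0: "d \<le> \<bar>x - p\<bar> \<Longrightarrow> tent p d x = 0"
  by (simp add: tent_def)

lemma uniform_Icc: "x \<le> y \<Longrightarrow> bump 0 0 {x..y} = y - x"
  by (simp add: bump_Icc tent_eq_0)

section \<open>Gains over the uniform valuation\<close>

lemma sweep_uniform_le:
  assumes "\<And>i. i \<in> set \<pi> \<Longrightarrow> V i = bump 0 0 \<and> 0 < w i" "distinct \<pi>" "0 \<le> z"
    "z + sum w (set \<pi>) \<le> 1"
  shows "sweep V w \<pi> z \<le> z + sum w (set \<pi>)"
  using assms
proof (induction \<pi> arbitrary: z)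
  case (Cons i \<pi>)
  interpret hungry_valuation "bump 0 0" by (rule hungry_valuation_bump) auto
  have i: "V i = bump 0 0" "0 < w i" using Cons.prems(1)[of i] by auto
  have pos: "0 \<le> sum w (set \<pi>)" using Cons.prems(1) by (intro sum_nonneg) (simp add: less_imp_le)
  have s: "sum w (set (i # \<pi>)) = w i + sum w (set \<pi>)" using Cons.prems(2) by simp
  have "cut_point (V i) z (w i) \<le> z + w i"
    unfolding i(1) using Cons.prems(3,4) i(2) pos s by (intro cut_le) (auto simp: uniform_Icc)
  moreover from this have "sweep V w \<pi> (cut_point (V i) z (w i))
      \<le> cut_point (V i) z (w i) + sum w (set \<pi>)"
    using Cons.prems s by (intro Cons.IH) (auto simp: cut_point_bounds)
  ultimately show ?case using s by simp
qed simp

text \<open>The pieces have total length at most \<open>1 = sum w {1..n}\<close> but larger total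
  value. This refutes allocations for uniform valuations and exposes a gaining piece
  otherwise.\<close>

lemma conn_strong_prop_gain:
  assumes "hungry_instance n w V" "conn_strong_prop n w V X"
  shows "\<exists>i\<in>{1..n}. \<exists>a b. X i = {a..b} \<and> 0 \<le> a \<and> a < b \<and> b \<le> 1 \<and> b - a < V i {a..b}"
proof -
  obtain a b where
    ab: "\<And>i. i \<in> {1..n} \<Longrightarrow> X i = {a i..b i} \<and> 0 \<le> a i \<and> a i < b i \<and> b i \<le> 1 \<and> w i < V i {a i..b i}"
    and dis: "\<And>i j. i \<in> {1..n} \<Longrightarrow> j \<in> {1..n} \<Longrightarrow> i \<noteq> j \<Longrightarrow> b i \<le> a j \<or> b j \<le> a i"
    using conn_strong_prop_pieces[OF assms] by metis
  have "(\<Sum>i\<in>{1..n}. b i - a i) \<le> 1" using ab dis by (intro sum_lengths_le_one) auto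
  also have "1 = sum w {1..n}" using hungry_instanceD(3)[OF assms(1)] by simp
  also have "\<dots> < (\<Sum>i\<in>{1..n}. V i {a i..b i})"
    using ab hungry_instanceD(4)[OF assms(1)] by (intro sum_strict_mono) auto
  finally have "\<exists>i\<in>{1..n}. b i - a i < V i {a i..b i}"
    by (meson not_less sum_mono)
  then show ?thesis using ab by blast
qed

text \<open>\<open>P\<close> holds the touched pairs. Agent \<open>i\<close> gets a bump at the
  untouched point \<open>p\<close>, too narrow to be seen on \<open>P\<close>; then \<open>i\<close>
  finishes before \<open>p\<close> in the order \<open>S\<close>, \<open>i\<close>, rest. The last
  conclusion holds because the tent vanishes at a touched \<open>b\<close> and is nonnegative at
  \<open>a\<close>.\<close>

lemma perturbed_instance:
  assumes w: "entitlements n w" and i: "i \<in> {1..n}" and S: "S \<subset> {1..n} - {i}"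
    and P: "finite P" "(i, w i + sum w S) \<notin> P"
  obtains V where "hungry_instance n w V" "\<exists>X. conn_strong_prop n w V X"
    "\<And>j x. (j, x) \<in> P \<Longrightarrow> x \<in> cake \<Longrightarrow> V j {0..x} = x"
    "\<And>j a b. (j, b) \<in> P \<Longrightarrow> a \<le> b \<Longrightarrow> V j {a..b} \<le> b - a"
proof -
  define p where "p = w i + sum w S"
  define R where "R = {1..n} - {i} - S"
  have fin: "finite S" "finite R" using S finite_subset by (auto simp: R_def)
  have wpos: "0 < w j" if "j \<in> {1..n}" for j using w that by (simp add: entitlements_def)
  have wi: "0 < w i" by (rule wpos[OF i])
  have s0: "0 \<le> sum w S" using S wpos by (intro sum_nonneg) (meson DiffD1 less_imp_le psubsetD)
  \<comment> \<open>As \<open>S\<close> is a proper subset, someone is served after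
    \<open>i\<close>; hence \<open>p < 1\<close> and there is room right of
    \<open>p\<close>.\<close>
  have "R \<noteq> {}" using S by (auto simp: R_def)
  then have r0: "0 < sum w R" using fin wpos by (intro sum_pos) (auto simp: R_def)
  have "sum w {1..n} = w i + sum w ({1..n} - {i})" using i by (intro sum.remove) auto
  also have "sum w ({1..n} - {i}) = sum w S + sum w R"
    unfolding R_def using S by (subst sum.subset_diff[of S]) auto
  finally have p1: "p + sum w R = 1" using w by (simp add: entitlements_def p_def)
  \<comment> \<open>Bounds for the width: \<open>p\<close> and \<open>1 - p\<close> keep the bump in
    the cake, \<open>w i\<close> makes the tent vanish at \<open>sum w S\<close>, the distances make
    it vanish at the touched points of \<open>i\<close>.\<close>
  define D where "D = {p, 1 - p, w i} \<union> (\<lambda>q. \<bar>snd q - p\<bar>) ` {q \<in> P. fst q = i}"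
  define d where "d = Min D"
  have finD: "finite D" "D \<noteq> {}" using P by (auto simp: D_def)
  have "\<forall>x\<in>D. 0 < x" using P(2) p1 r0 wi s0 by (auto simp: D_def p_def)
  then have d0: "0 < d" unfolding d_def using finD by simp
  have dle: "d \<le> x" if "x \<in> D" for x unfolding d_def using finD that by simp
  have d: "d \<le> p" "d \<le> 1 - p" "d \<le> w i" by (rule dle, simp add: D_def)+
  have dP: "tent p d x = 0" if "(i, x) \<in> P" for x
    by (rule tent_eq_0, rule dle) (use that in \<open>force simp: D_def\<close>)
  define V where "V j = (if j = i then bump p d else bump 0 0)" for j
  have hv: "hungry_valuation (V j)" for j
    using d0 d by (auto simp: V_def intro!: hungry_valuation_bump)
  then have inst: "hungry_instance n w V"
    using w by (simp add: hungry_instance_def hungry_valuation_def)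
  interpret hungry_valuation "V i" by (rule hv)
  obtain xs where xs: "set xs = S" "distinct xs" using finite_distinct_list[OF fin(1)] by blast
  obtain ys where ys: "set ys = R" "distinct ys" using finite_distinct_list[OF fin(2)] by blast
  define x where "x = sweep V w xs 0"
  have x0: "0 \<le> x" unfolding x_def by (rule sweep_bounds) auto
  have xle: "x \<le> sum w S"
    using sweep_uniform_le[of xs V w 0] xs S wpos p1 r0 wi
    by (force simp: x_def V_def p_def)
  have "V i {sum w S..p} = w i + d / 2"
    using d d0 wi by (simp add: V_def bump_Icc p_def tent_def)
  moreover have "V i {sum w S..p} \<le> V i {x..p}"
    using x0 xle wi p1 r0 by (intro Icc_mono) (auto simp: p_def)
  ultimately have c: "cut_point (V i) x (w i) < p"
    using x0 xle wi p1 r0 d0 by (intro cut_less) (auto simp: p_def)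
  have "sweep V w ys (cut_point (V i) x (w i)) \<le> cut_point (V i) x (w i) + sum w (set ys)"
    by (rule sweep_uniform_le)
       (use ys c p1 wpos in \<open>auto simp: V_def R_def cut_point_bounds\<close>)
  then have "sweep V w (xs @ [i] @ ys) 0 < 1" using c p1 ys by (simp add: x_def)
  moreover have "distinct (xs @ [i] @ ys)" "set (xs @ [i] @ ys) = {1..n}"
    using xs ys S i by (auto simp: R_def)
  ultimately have "\<exists>X. conn_strong_prop n w V X"
    unfolding conn_strong_prop_iff_sweep[OF inst] by blast
  moreover have "V j {0..x} = x" if "(j, x) \<in> P" "x \<in> cake" for j x
  proof (cases "j = i")
    case True
    have "tent p d 0 = 0" using d d0 by (intro tent_eq_0) auto
    with True show ?thesis using that dP d0 by (simp add: V_def bump_Icc cake_def)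
  qed (use that in \<open>simp add: V_def uniform_Icc cake_def\<close>)
  moreover have "V j {a..b} \<le> b - a" if "(j, b) \<in> P" "a \<le> b" for j a b
    using that dP d0 tent_nonneg[of p d a]
    by (cases "j = i") (simp_all add: V_def uniform_Icc bump_Icc[of d])
  ultimately show ?thesis using that inst by blast
qed

section \<open>Entitlements with distinct subset sums\<close>

definition binary_entitlement :: "nat \<Rightarrow> nat \<Rightarrow> real" where
  "binary_entitlement n i = 2 ^ i / (2 ^ (n + 1) - 2)"

text \<open>\<open>set_encode\<close> reads a finite set as a binary number, so for
  \<open>n > 0\<close> distinct finite sets have distinct sums.\<close>

lemma sum_binary_entitlement:
  "sum (binary_entitlement n) S = real (set_encode S) / (2 ^ (n + 1) - 2)"
  by (simp add: binary_entitlement_def set_encode_def sum_divide_distrib)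

lemma entitlements_binary:
  assumes "0 < n" shows "entitlements n (binary_entitlement n)"
proof -
  have "(2::real) ^ 1 < 2 ^ (n + 1)" using assms by (intro power_strict_increasing) auto
  then have pos: "0 < (2::real) ^ (n + 1) - 2" by simp
  have "(\<Sum>i\<in>{1..n}. (2::real) ^ i) = 2 ^ (n + 1) - 2"
    by (induction n) auto
  then have "sum (binary_entitlement n) {1..n} = 1"
    using pos by (simp add: binary_entitlement_def flip: sum_divide_distrib)
  moreover have "0 < binary_entitlement n i" for i
    using pos by (simp add: binary_entitlement_def)
  ultimately show ?thesis by (simp add: entitlements_def)
qed

text \<open>Pigeonhole: distinct subset sums give \<open>n * (2 ^ (n - 1) - 1)\<close> different
  candidate pairs, so a smaller \<open>P\<close> misses one.\<close>

lemma untouched_pair: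
  assumes "0 < n" "finite P" "card P < n * (2 ^ (n - 1) - 1)"
  obtains i S where "i \<in> {1..n}" "S \<subset> {1..n} - {i}"
    "(i, binary_entitlement n i + sum (binary_entitlement n) S) \<notin> P"
proof -
  let ?w = "binary_entitlement n"
  \<comment> \<open>The full set \<open>{1..n} - {i}\<close> is removed: its sum with
    \<open>i\<close> is \<open>1\<close>, where no agent is left to profit.\<close>
  define Q where "Q = (SIGMA i:{1..n}. Pow ({1..n} - {i}) - {{1..n} - {i}})"
  define f where "f q = (fst q, ?w (fst q) + sum ?w (snd q))" for q
  have f: "f (i, S) = (i, sum ?w (insert i S))" if "(i, S) \<in> Q" for i S
  proof -
    have "S \<subseteq> {1..n} - {i}" using that by (auto simp: Q_def)
    then have "finite S" "i \<notin> S" using finite_subset by auto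
    then show ?thesis by (simp add: f_def)
  qed
  have "(2::real) ^ 1 < 2 ^ (n + 1)" using assms by (intro power_strict_increasing) auto
  then have nz: "(2::real) ^ (n + 1) - 2 \<noteq> 0" by simp
  have "inj_on f Q"
  proof (rule inj_onI)
    fix q r assume qr: "q \<in> Q" "r \<in> Q" "f q = f r"
    obtain i S j T where q: "q = (i, S)" and r: "r = (j, T)" by fastforce
    have ij: "i = j" and eq: "sum ?w (insert i S) = sum ?w (insert i T)"
      using qr(3) f[of i S] f[of j T] qr(1,2) q r by auto
    have ST: "S \<subseteq> {1..n} - {i}" "T \<subseteq> {1..n} - {i}" using qr(1,2) q r ij by (auto simp: Q_def)
    then have fin: "finite S" "finite T" by (auto elim: finite_subset)
    have "set_encode (insert i S) = set_encode (insert i T)"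
      using eq nz by (simp only: sum_binary_entitlement) simp
    then have "insert i S = insert i T" using fin by (simp add: set_encode_eq)
    then have "S = T" using ST by blast
    then show "q = r" using q r ij by simp
  qed
  then have "card (f ` Q) = card Q" by (rule card_image)
  also have "card Q = (\<Sum>i\<in>{1..n}. card (Pow ({1..n} - {i}) - {{1..n} - {i}}))"
    unfolding Q_def by (rule card_SigmaI) auto
  also have "\<dots> = (\<Sum>i\<in>{1..n}. 2 ^ (n - 1) - 1)"
    by (intro sum.cong refl) (simp add: card_Diff_subset card_Pow)
  also have "\<dots> = n * (2 ^ (n - 1) - 1)" by simp
  finally have "card P < card (f ` Q)" using assms(3) by simp
  then have "\<not> f ` Q \<subseteq> P" using card_mono[OF assms(2)] by (metis not_less)
  then obtain q where "q \<in> Q" "f q \<notin> P" by blast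
  moreover obtain i S where "q = (i, S)" by (cases q)
  ultimately show ?thesis by (intro that[of i S]) (auto simp: Q_def f_def)
qed

section \<open>The adversary argument\<close>

text \<open>The guard \<open>x \<in> cake\<close> matters because a mark query also touches
  \<open>x + r\<close>, which may exceed \<open>1\<close>.\<close>

definition uniform_at :: "nat \<Rightarrow> (nat \<times> real) set \<Rightarrow> (nat \<Rightarrow> real set \<Rightarrow> real) \<Rightarrow> bool" where
  "uniform_at n P V \<longleftrightarrow> (\<forall>i\<in>{1..n}. hungry_valuation (V i)) \<and>
     (\<forall>(i, x)\<in>P. x \<in> cake \<longrightarrow> V i {0..x} = x)"

text \<open>As long as the answers are those of the uniform valuation, a query depends on the valuation
  only through the values of two initial segments of the cake.\<close>

lemma uniform_transcript:
  assumes "legal n T"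
  shows "\<exists>P out. finite P \<and> card P \<le> 2 * N \<and>
    (\<forall>V. uniform_at n P V \<longrightarrow> queries V T \<le> N \<longrightarrow> run V T = out)"
  using assms
proof (induction T arbitrary: N)
  case (Return a)
  show ?case by (intro exI[of _ "{}"] exI[of _ a]) simp
next
  case (Eval i x y k)
  show ?case
  proof (cases N)
    case 0
    \<comment> \<open>A query node costs at least one query, so \<open>queries V _ \<le> 0\<close>
      is impossible and any output will do.\<close>
    then show ?thesis by (intro exI[of _ "{}"]) simp
  next
    case (Suc M)
    have "legal n (k (y - x))" using Eval.prems by simp
    from Eval.IH[OF rangeI this, of M] obtain P out where P: "finite P" "card P \<le> 2 * M" and
      out: "\<forall>V. uniform_at n P V \<longrightarrow> queries V (k (y - x)) \<le> M \<longrightarrow> run V (k (y - x)) = out"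
      by (elim exE conjE)
    define P' where "P' = insert (i, x) (insert (i, y) P)"
    have "run V (Eval i x y k) = out"
      if V: "uniform_at n P' V" "queries V (Eval i x y k) \<le> N" for V
    proof -
      have i: "i \<in> {1..n}" using Eval.prems by simp
      interpret hungry_valuation "V i" using V(1) i by (simp add: uniform_at_def)
      have "V i {0..x} = x" "V i {0..y} = y"
        using V(1) Eval.prems by (simp_all add: uniform_at_def P'_def cake_def)
      then have "eval_query (V i) x y = y - x"
        using split[of 0 x y] Eval.prems by (simp add: eval_query_def)
      moreover have "uniform_at n P V" using V(1) by (simp add: uniform_at_def P'_def)
      ultimately show ?thesis using V(2) out Suc by simp
    qed
    moreover have "finite P'" "card P' \<le> 2 * N"
      using P Suc by (simp_all add: P'_def card_insert_if)
    ultimately show ?thesis by blast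
  qed
next
  case (Mark i x r k)
  \<comment> \<open>The answer of the uniform valuation. In the case \<open>\<infinity>\<close> the
    value at \<open>x\<close> alone determines it, since the whole cake is worth
    \<open>1\<close>.\<close>
  define ans where "ans = (if 1 - x < r then \<infinity> else ereal (x + r))"
  show ?case
  proof (cases N)
    case 0
    then show ?thesis by (intro exI[of _ "{}"]) simp
  next
    case (Suc M)
    have "legal n (k ans)" using Mark.prems by simp
    from Mark.IH[OF rangeI this, of M] obtain P out where P: "finite P" "card P \<le> 2 * M" and
      out: "\<forall>V. uniform_at n P V \<longrightarrow> queries V (k ans) \<le> M \<longrightarrow> run V (k ans) = out"
      by (elim exE conjE)
    define P' where "P' = insert (i, x) (insert (i, x + r) P)"
    have "run V (Mark i x r k) = out"
      if V: "uniform_at n P' V" "queries V (Mark i x r k) \<le> N" for V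
    proof -
      have i: "i \<in> {1..n}" using Mark.prems by simp
      interpret hungry_valuation "V i" using V(1) i by (simp add: uniform_at_def)
      have x: "0 \<le> x" "x \<le> 1" "0 \<le> r" using Mark.prems by (simp_all add: cake_def)
      have vx: "V i {0..x} = x" using V(1) x by (simp add: uniform_at_def P'_def cake_def)
      have "V i {0..1} = 1" using valuation by (simp add: valuation_def cake_def)
      then have v1: "V i {x..1} = 1 - x" using split[of 0 x 1] vx x by simp
      have "mark_query (V i) x r = ans"
      proof (cases "1 - x < r")
        case True
        then show ?thesis using v1 by (simp add: mark_query_def ans_def)
      next
        case False
        then have "V i {0..x + r} = x + r"
          using V(1) x by (simp add: uniform_at_def P'_def cake_def)
        then have "V i {x..x + r} = r" using split[of 0 x "x + r"] vx x False by simp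
        then show ?thesis using mark_query_eqI[of x "x + r" r] x False by (simp add: ans_def)
      qed
      moreover have "uniform_at n P V" using V(1) by (simp add: uniform_at_def P'_def)
      ultimately show ?thesis using V(2) out Suc by simp
    qed
    moreover have "finite P'" "card P' \<le> 2 * N"
      using P Suc by (simp_all add: P'_def card_insert_if)
    ultimately show ?thesis by blast
  qed
qed

lemma query_complexity_ge:
  assumes "\<And>A. (\<And>w. legal n (A w)) \<Longrightarrow> (\<And>w V. (w, V) \<in> D \<Longrightarrow> R w V (run V (A w))) \<Longrightarrow>
    (\<And>w V. (w, V) \<in> D \<Longrightarrow> queries V (A w) \<le> N) \<Longrightarrow> False"
  shows "enat N \<le> query_complexity n D R"
  unfolding query_complexity_def
proof (rule INF_greatest)
  fix A assume A: "A \<in> {A. (\<forall>w. legal n (A w)) \<and> (\<forall>(w, V)\<in>D. R w V (run V (A w)))}"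
  obtain w V where "(w, V) \<in> D" "N < queries V (A w)"
  proof (rule ccontr)
    assume *: "\<not> thesis"
    show False
    proof (rule assms[of A])
      show "queries V (A w) \<le> N" if "(w, V) \<in> D" for w V
        using * \<open>\<And>V w. (w, V) \<in> D \<Longrightarrow> N < queries V (A w) \<Longrightarrow> thesis\<close> that not_le by blast
    qed (use A in auto)
  qed
  then show "enat N \<le> (SUP (w, V)\<in>D. enat (queries V (A w)))"
    by (intro SUP_upper2[of "(w, V)"]) auto
qed

text \<open>The uniform instance has no allocation, a perturbed one has; they agree on all touched
  pairs, at most \<open>2 * N\<close> of them, and so receive the same answer.\<close>

lemma decision_complexity_ge:
  assumes "0 < n" "2 * N < n * (2 ^ (n - 1) - 1)"
  shows "enat N \<le> decision_complexity n"
  unfolding decision_complexity_def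
proof (rule query_complexity_ge)
  fix A
  assume legal: "\<And>w. legal n (A w)"
    and correct: "\<And>w V. (w, V) \<in> {(w, V). hungry_instance n w V} \<Longrightarrow>
      run V (A w) \<longleftrightarrow> (\<exists>X. conn_strong_prop n w V X)"
    and cost: "\<And>w V. (w, V) \<in> {(w, V). hungry_instance n w V} \<Longrightarrow> queries V (A w) \<le> N"
  define w where "w = binary_entitlement n"
  have w: "entitlements n w" unfolding w_def by (rule entitlements_binary[OF assms(1)])
  obtain P out where P: "finite P" "card P \<le> 2 * N" and
    out: "\<forall>V. uniform_at n P V \<longrightarrow> queries V (A w) \<le> N \<longrightarrow> run V (A w) = out"
    using uniform_transcript[OF legal[of w], of N] by (elim exE conjE)
  obtain i S where "i \<in> {1..n}" "S \<subset> {1..n} - {i}" "(i, w i + sum w S) \<notin> P"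
    using untouched_pair[OF assms(1) P(1)] P(2) assms(2) unfolding w_def by (metis le_less_trans)
  then obtain V where V: "hungry_instance n w V" "\<exists>X. conn_strong_prop n w V X"
    "\<And>j x. (j, x) \<in> P \<Longrightarrow> x \<in> cake \<Longrightarrow> V j {0..x} = x"
    using perturbed_instance[OF w _ _ P(1)] by metis
  define U :: "nat \<Rightarrow> real set \<Rightarrow> real" where "U j = bump 0 0" for j
  have "hungry_valuation (bump 0 0)" by (rule hungry_valuation_bump) auto
  then have U: "hungry_instance n w U"
    using w by (simp add: U_def hungry_instance_def hungry_valuation_def)
  have "uniform_at n P V"
    using V(3) hungry_instanceD(1)[OF V(1)] by (auto simp: uniform_at_def)
  then have "run V (A w) = out" using V(1) cost out by simp
  moreover have "uniform_at n P U"
    using \<open>hungry_valuation (bump 0 0)\<close> by (auto simp: uniform_at_def U_def uniform_Icc cake_def)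
  then have "run U (A w) = out" using U cost out by simp
  moreover have "\<nexists>X. conn_strong_prop n w U X"
    using conn_strong_prop_gain[OF U] by (force simp: U_def uniform_Icc)
  ultimately show False using correct[of w V] correct[of w U] V U by simp
qed

text \<open>The uniform instance is outside the domain, but its transcript still fixes an output
  \<open>X\<close>. A perturbed instance follows that transcript, yet no piece of \<open>X\<close>
  can gain on it.\<close>

lemma search_complexity_ge:
  assumes "0 < n" "2 * N + n < n * (2 ^ (n - 1) - 1)"
  shows "enat N \<le> search_complexity n"
  unfolding search_complexity_def
proof (rule query_complexity_ge)
  let ?D = "{(w, V). hungry_instance n w V \<and> (\<exists>X. conn_strong_prop n w V X)}"
  fix A
  assume legal: "\<And>w. legal n (A w)"
    and correct: "\<And>w V. (w, V) \<in> ?D \<Longrightarrow> conn_strong_prop n w V (run V (A w))"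
    and cost: "\<And>w V. (w, V) \<in> ?D \<Longrightarrow> queries V (A w) \<le> N"
  define w where "w = binary_entitlement n"
  have w: "entitlements n w" unfolding w_def by (rule entitlements_binary[OF assms(1)])
  obtain P X where P: "finite P" "card P \<le> 2 * N" and
    X: "\<forall>V. uniform_at n P V \<longrightarrow> queries V (A w) \<le> N \<longrightarrow> run V (A w) = X"
    using uniform_transcript[OF legal[of w], of N] by (elim exE conjE)
  text \<open>The right ends of the pieces of the output count as touched, too: an agent whose valuation
    of initial segments is perturbed upwards gains nothing from a piece that ends elsewhere.\<close>
  define P' where "P' = P \<union> (\<lambda>i. (i, Sup (X i))) ` {1..n}"
  have "card P' \<le> card P + card ((\<lambda>i. (i, Sup (X i))) ` {1..n})"
    unfolding P'_def by (rule card_Un_le)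
  also have "\<dots> \<le> 2 * N + n"
    using P(2) card_image_le[of "{1..n}" "\<lambda>i. (i, Sup (X i))"] by simp
  finally have P': "finite P'" "card P' < n * (2 ^ (n - 1) - 1)"
    using P(1) assms(2) by (auto simp: P'_def)
  obtain i S where "i \<in> {1..n}" "S \<subset> {1..n} - {i}" "(i, w i + sum w S) \<notin> P'"
    using untouched_pair[OF assms(1) P'] unfolding w_def by metis
  then obtain V where V: "hungry_instance n w V" "\<exists>X. conn_strong_prop n w V X"
    "\<And>j x. (j, x) \<in> P' \<Longrightarrow> x \<in> cake \<Longrightarrow> V j {0..x} = x"
    "\<And>j a b. (j, b) \<in> P' \<Longrightarrow> a \<le> b \<Longrightarrow> V j {a..b} \<le> b - a"
    using perturbed_instance[OF w _ _ P'(1)] by metis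
  have "uniform_at n P V"
    using V(3) hungry_instanceD(1)[OF V(1)] by (auto simp: uniform_at_def P'_def)
  then have "run V (A w) = X" using V(1,2) cost X by simp
  then have "conn_strong_prop n w V X" using correct[of w V] V by simp
  from conn_strong_prop_gain[OF V(1) this] obtain j a b where
    j: "j \<in> {1..n}" "X j = {a..b}" "a < b" "b - a < V j {a..b}" by auto
  then have "(j, b) \<in> P'" by (force simp: P'_def)
  then show False using V(4)[of j b a] j by simp
qed

theorem theorem6:
  "\<exists>d s :: nat \<Rightarrow> nat.
     (\<forall>n. decision_complexity n = enat (d n)) \<and>
     (\<forall>n. search_complexity n = enat (s n)) \<and>
     (\<lambda>n. real (d n)) \<in> \<Theta>(\<lambda>n. real n * 2 ^ n) \<and>
     (\<lambda>n. real (s n)) \<in> \<Theta>(\<lambda>n. real n * 2 ^ n)"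
proof -
  have "\<forall>n. \<exists>d. decision_complexity n = enat d"
    using decision_complexity_le by (metis enat_ile)
  then obtain d where d: "\<And>n. decision_complexity n = enat (d n)" by metis
  have "\<forall>n. \<exists>s. search_complexity n = enat s"
    using search_complexity_le by (metis enat_ile)
  then obtain s where s: "\<And>n. search_complexity n = enat (s n)" by metis
  \<comment> \<open>\<open>m * 2 ^ (m - 4)\<close> is a value of \<open>N\<close> that meets the
    premises of both lower bounds.\<close>
  have gap: "2 * (m * 2 ^ (m - 4)) + m < m * (2 ^ (m - 1) - 1)" if m: "4 \<le> m" for m :: nat
  proof -
    obtain k where k: "m = k + 4" using m by (metis add.commute le_Suc_ex)
    have "2 * 2 ^ k + 1 < (8 * 2 ^ k - 1 :: nat)"
      using one_le_power[of "2::nat" k] by linarith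
    then have "m * (2 * 2 ^ k + 1) < m * (8 * 2 ^ k - 1)"
      using m by (intro mult_strict_left_mono) auto
    moreover have "2 ^ (m - 1) = (8 * 2 ^ k :: nat)" "m - 4 = k" using k by (auto simp: power_add)
    ultimately show ?thesis by (simp only: distrib_left mult.left_commute mult_1_right)
  qed
  \<comment> \<open>The constants: \<open>3 * n \<le> 3 * (n * 2 ^ n)\<close> gives \<open>4\<close>
    above, and \<open>2 ^ (n - 4) = 2 ^ n / 16\<close> gives \<open>1 / 16\<close> below.\<close>
  have theta: "(\<lambda>n. real (f n)) \<in> \<Theta>(\<lambda>n. real n * 2 ^ n)"
    if up: "\<And>n. f n \<le> n * 2 ^ n + 3 * n" and low: "\<And>n. 4 \<le> n \<Longrightarrow> n * 2 ^ (n - 4) \<le> f n"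
    for f :: "nat \<Rightarrow> nat"
  proof (rule bigthetaI)
    show "(\<lambda>n. real (f n)) \<in> O(\<lambda>n. real n * 2 ^ n)"
    proof (rule bigoI[where c = 4], rule always_eventually, rule allI)
      fix n :: nat
      have "n * 1 \<le> n * 2 ^ n" by (intro mult_le_mono2) simp
      then have "f n \<le> 4 * (n * 2 ^ n)" using up[of n] by linarith
      then have "real (f n) \<le> real (4 * (n * 2 ^ n))" by (rule of_nat_mono)
      then show "norm (real (f n)) \<le> 4 * norm (real n * 2 ^ n)" by simp
    qed
    show "(\<lambda>n. real (f n)) \<in> \<Omega>(\<lambda>n. real n * 2 ^ n)"
    proof (rule landau_omega.bigI[where c = "1 / 16"])
      show "\<forall>\<^sub>F n in sequentially. 1 / 16 * norm (real n * 2 ^ n) \<le> norm (real (f n))"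
        using eventually_ge_at_top[of 4]
      proof eventually_elim
        case (elim n)
        then obtain k where k: "n = k + 4" by (metis add.commute le_Suc_ex)
        have "real (n * 2 ^ (n - 4)) \<le> real (f n)" using low[OF elim] by (rule of_nat_mono)
        then show ?case using k by (simp add: power_add)
      qed
    qed simp
  qed
  have "(\<lambda>n. real (d n)) \<in> \<Theta>(\<lambda>n. real n * 2 ^ n)"
  proof (rule theta)
    show "d n \<le> n * 2 ^ n + 3 * n" for n
      using decision_complexity_le[of n] by (simp add: d)
    show "n * 2 ^ (n - 4) \<le> d n" if "4 \<le> n" for n
    proof -
      have "enat (n * 2 ^ (n - 4)) \<le> decision_complexity n"
        by (rule decision_complexity_ge) (use that gap[OF that] in linarith)+
      then show ?thesis by (simp add: d)
    qed
  qed
  moreover have "(\<lambda>n. real (s n)) \<in> \<Theta>(\<lambda>n. real n * 2 ^ n)"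
  proof (rule theta)
    show "s n \<le> n * 2 ^ n + 3 * n" for n
      using search_complexity_le[of n] by (simp add: s)
    show "n * 2 ^ (n - 4) \<le> s n" if "4 \<le> n" for n
    proof -
      have "enat (n * 2 ^ (n - 4)) \<le> search_complexity n"
        by (rule search_complexity_ge) (use that gap[OF that] in linarith)+
      then show ?thesis by (simp add: s)
    qed
  qed
  ultimately show ?thesis using d s by blast
qed

end
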